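(* Let $\Omega\subset\mathbb{R}^n$ be a strictly convex bounded domain with smooth boundary and let $p\ge 2$. Let $a^{ij}:\mathbb{R}^n\to\mathbb{R}$ ($1\le i,j\le n$) and $b_1,b_2,b_3:\mathbb{R}\to\mathbb{R}$ be smooth, and suppose there is a constant $c_0>0$ such that $a^{ij}(q)\xi_i\xi_j\ge c_0|\xi|^2>0$ for all $q\in\mathbb{R}^n$ and all $\xi\in\mathbb{R}^n\setminus\{0\}$. Let $\rho:\mathbb{R}\to\mathbb{R}$ be smooth and strictly positive on $\mathbb{R}\setminus\{0\}$. Assume that (1) $b_1$, $b_2$ and $b_3$ are convex functions, and (2) $\rho''(s)-\dfrac{(\rho'(s))^2}{2\rho(s)}=0$ for all $s\neq 0$. Let $w$ be a positive smooth solution on $\Omega\times[0,\infty)$ of $$w_t=\rho(w)\,a^{ij}(\nabla w)\,w_{ij}+b_1(w)|\nabla w|^p+b_2(w)|\nabla w|^2+b_3(w).$$ If $$\inf_{(x,t)\in\partial\Omega\times[0,\infty)}\ \inf_{|e_\alpha|=1}w_{\alpha\alpha}(x,t)>0\qquad\text{and}\qquad \inf_{x\in\Omega}\ \inf_{|e_\alpha|=1}w_{\alpha\alpha}(x,0)>0,$$ then $w$ is convex in the space variable for all $t>0$, i.e. $$\inf_{(x,t)\in\Omega\times[0,\infty)}\ \inf_{|e_\alpha|=1}w_{\alpha\alpha}(x,t)\ge 0 .$$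
   Context: Subscripts $i,j$ denote differentiation with respect to the space variables $x_1,\dots,x_n$, and repeated indices are summed from $1$ to $n$. For a unit vector $e_\alpha\in\mathbb{R}^n$, $w_{\alpha\alpha}$ denotes the second spatial derivative of $w$ in the direction $e_\alpha$. The solution $w$ is understood to be smooth enough up to the lateral boundary $\partial\Omega\times[0,\infty)$ and the initial time for the boundary and initial second derivatives to make sense. *)

theory Defs
  imports "HOL-Analysis.Analysis"
begin

text \<open>
  All derivatives are Frechet derivatives within a set \<open>S\<close>. They are used only for \<open>S\<close> open, or
  convex with nonempty interior, where the derivative at each point of \<open>S\<close> is unique: at interior
  points it is the ordinary derivative, at boundary points of \<open>S\<close> the one-sided one.
\<close>

definition dir_deriv :: "'a::real_normed_vector set \<Rightarrow> 'a \<Rightarrow> ('a \<Rightarrow> real) \<Rightarrow> 'a \<Rightarrow> real" where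
  "dir_deriv S v f x = frechet_derivative f (at x within S) v"

fun Ck_on :: "nat \<Rightarrow> 'a::real_normed_vector set \<Rightarrow> ('a \<Rightarrow> real) \<Rightarrow> bool" where
  "Ck_on 0 S f \<longleftrightarrow> continuous_on S f"
| "Ck_on (Suc k) S f \<longleftrightarrow> f differentiable_on S \<and> (\<forall>v. Ck_on k S (dir_deriv S v f))"

definition smooth_on :: "'a::real_normed_vector set \<Rightarrow> ('a \<Rightarrow> real) \<Rightarrow> bool" where
  "smooth_on S f \<longleftrightarrow> (\<forall>k. Ck_on k S f)"

definition gradient :: "(real ^ 'n) set \<Rightarrow> (real ^ 'n \<Rightarrow> real) \<Rightarrow> real ^ 'n \<Rightarrow> real ^ 'n" where
  "gradient S f x = (\<chi> i. dir_deriv S (axis i 1) f x)"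

definition dir_deriv2 ::
    "'a::real_normed_vector set \<Rightarrow> 'a \<Rightarrow> 'a \<Rightarrow> ('a \<Rightarrow> real) \<Rightarrow> 'a \<Rightarrow> real" where
  "dir_deriv2 S u v f = dir_deriv S v (dir_deriv S u f)"

definition strictly_convex_set :: "'a::real_normed_vector set \<Rightarrow> bool" where
  "strictly_convex_set S \<longleftrightarrow> (\<forall>x\<in>closure S. \<forall>y\<in>closure S. open_segment x y \<subseteq> interior S)"

text \<open>Smooth boundary, by local smooth defining functions with nonvanishing derivative.\<close>

definition smooth_boundary :: "'a::real_normed_vector set \<Rightarrow> bool" where
  "smooth_boundary \<Omega> \<longleftrightarrow>
     (\<forall>z\<in>frontier \<Omega>. \<exists>U \<phi>. open U \<and> z \<in> U \<and> smooth_on U \<phi> \<and>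
        (\<forall>y\<in>U. (y \<in> \<Omega> \<longleftrightarrow> \<phi> y < 0) \<and> (y \<in> frontier \<Omega> \<longleftrightarrow> \<phi> y = 0)) \<and>
        (\<forall>y\<in>U. \<exists>v. dir_deriv U v \<phi> y \<noteq> 0))"

text \<open>
  The regularity of \<open>w\<close> (a function of \<open>x\<close> and \<open>t\<close>) that gives a meaning to its spatial second
  derivatives on the lateral boundary and at the initial time: up to order two the spatial
  derivatives exist up to the boundary of \<open>\<Omega>\<close>, and those of order two are jointly continuous in
  space and time.
\<close>

definition spatially_C2_up_to_boundary ::
    "'a::real_normed_vector set \<Rightarrow> ('a \<Rightarrow> real \<Rightarrow> real) \<Rightarrow> bool" where
  "spatially_C2_up_to_boundary \<Omega> w \<longleftrightarrow>
     (\<forall>t\<ge>0. Ck_on 2 (closure \<Omega>) (\<lambda>x. w x t)) \<and>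
     (\<forall>u v. continuous_on (closure \<Omega> \<times> {0..})
        (\<lambda>(x, t). dir_deriv2 (closure \<Omega>) u v (\<lambda>y. w y t) x))"

definition space_grad ::
    "(real ^ 'n) set \<Rightarrow> (real ^ 'n \<Rightarrow> real \<Rightarrow> real) \<Rightarrow> real ^ 'n \<Rightarrow> real \<Rightarrow> real ^ 'n" where
  "space_grad \<Omega> w x t = gradient (closure \<Omega>) (\<lambda>y. w y t) x"

definition space_deriv2 ::
    "'a::real_normed_vector set \<Rightarrow> 'a \<Rightarrow> 'a \<Rightarrow> ('a \<Rightarrow> real \<Rightarrow> real) \<Rightarrow> 'a \<Rightarrow> real \<Rightarrow> real" where
  "space_deriv2 \<Omega> u v w x t = dir_deriv2 (closure \<Omega>) u v (\<lambda>y. w y t) x"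

definition time_deriv :: "('a \<Rightarrow> real \<Rightarrow> real) \<Rightarrow> 'a \<Rightarrow> real \<Rightarrow> real" where
  "time_deriv w x t = vector_derivative (w x) (at t within {0..})"

end

theory Submission
  imports Defs
begin

text \<open>
  If some \<open>w\<^sub>e\<^sub>e\<close> is negative before time \<open>T\<close>, minimise \<open>exp (- \<kappa> t) w\<^sub>e\<^sub>e(x, t)\<close> over \<open>x\<close>, \<open>t \<le> T\<close> and unit
  vectors \<open>e\<close>. The boundary and initial conditions put the minimum \<open>(x\<^sub>0, t\<^sub>0, \<alpha>)\<close> at an interior point
  with \<open>t\<^sub>0 > 0\<close>; there \<open>\<lambda> = w\<^sub>\<alpha>\<^sub>\<alpha> < 0\<close> and \<open>\<partial>\<^sub>t w\<^sub>\<alpha>\<^sub>\<alpha> \<le> \<kappa> \<lambda>\<close>. Moreover \<open>\<alpha>\<close> is an eigenvector of the Hessian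
  and \<open>\<nabla>w\<^sub>\<alpha>\<^sub>\<alpha> = 0\<close>, so differentiating the equation twice along \<open>\<alpha>\<close> produces only multiples of \<open>\<lambda>\<close>,
  nonnegative terms \<open>b'' w\<^sub>\<alpha>\<^sup>2 |\<nabla>w|\<^sup>p\<close>, and
  \<open>\<rho> a\<^sup>i\<^sup>j w\<^sub>i\<^sub>j\<^sub>\<alpha>\<^sub>\<alpha> + 2 \<rho>' w\<^sub>\<alpha> a\<^sup>i\<^sup>j w\<^sub>i\<^sub>j\<^sub>\<alpha> + \<rho>'' w\<^sub>\<alpha>\<^sup>2 a\<^sup>i\<^sup>j w\<^sub>i\<^sub>j\<close>. Varying the direction together with the point
  (\<open>\<alpha> + s c \<xi>\<close> at \<open>x\<^sub>0 + s \<xi>\<close>) gives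
  \<open>w\<^sub>\<alpha>\<^sub>\<alpha>\<^sub>\<xi>\<^sub>\<xi> + 4 c w\<^sub>\<alpha>\<^sub>\<xi>\<^sub>\<xi> + 2 c\<^sup>2 w\<^sub>\<xi>\<^sub>\<xi> - 2 \<lambda> c\<^sup>2 |\<xi>|\<^sup>2 \<ge> 0\<close> for all \<open>\<xi>\<close> and \<open>c\<close>. Tracing this form against \<open>a\<^sup>i\<^sup>j\<close>
  with \<open>c = \<rho>' w\<^sub>\<alpha> / (2 \<rho>)\<close> bounds the three terms from below by a multiple of \<open>\<lambda>\<close>, because condition (2) says
  \<open>2 c\<^sup>2 \<rho> = \<rho>'' w\<^sub>\<alpha>\<^sup>2\<close>. Hence \<open>\<partial>\<^sub>t w\<^sub>\<alpha>\<^sub>\<alpha> \<ge> C \<lambda>\<close> with \<open>C\<close> uniform on the compact set where \<open>w\<^sub>e\<^sub>e \<le> 0\<close>, a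
  contradiction for \<open>\<kappa> = C + 1\<close>.
\<close>

section \<open>Directional derivatives on open sets\<close>

lemma dir_deriv_cong:
  assumes "\<And>y. y \<in> S \<Longrightarrow> f y = g y" "x \<in> S"
  shows "dir_deriv S v f x = dir_deriv S v g x"
proof -
  have "(f has_derivative D) (at x within S) \<longleftrightarrow> (g has_derivative D) (at x within S)" for D
    using assms has_derivative_transform[of x S f g D] has_derivative_transform[of x S g f D] by auto
  then show ?thesis
    unfolding dir_deriv_def frechet_derivative_def by simp
qed

lemma Ck_on_cong:
  assumes "\<And>y. y \<in> S \<Longrightarrow> f y = g y"
  shows "Ck_on k S f \<longleftrightarrow> Ck_on k S g"
  using assms
proof (induction k arbitrary: f g)
  case 0
  then show ?case by (simp cong: continuous_on_cong)
next
  case (Suc k)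
  have "f differentiable_on S \<longleftrightarrow> g differentiable_on S"
    unfolding differentiable_on_def
    using Suc.prems differentiable_transform_within[of _ _ S 1] by (metis zero_less_one)
  moreover have "Ck_on k S (dir_deriv S v f) \<longleftrightarrow> Ck_on k S (dir_deriv S v g)" for v
    by (intro Suc.IH dir_deriv_cong Suc.prems) auto
  ultimately show ?case by simp
qed

lemma dir_deriv_open_subset:
  assumes "open T" "T \<subseteq> S" "x \<in> T"
  shows "dir_deriv T v f x = dir_deriv S v f x"
  using at_within_open_subset[OF assms(3,1,2)] at_within_open[OF assms(3,1)]
  unfolding dir_deriv_def by simp

text \<open>For open \<open>T\<close> the derivatives within \<open>T\<close> and within
  \<open>S\<close> agree on \<open>T\<close>. This restricts one-sided regularity on a larger set to
  the open domain.\<close>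

lemma Ck_on_open_subset:
  assumes "open T" "T \<subseteq> S" "Ck_on k S f"
  shows "Ck_on k T f"
  using assms(3)
proof (induction k arbitrary: f)
  case 0
  then show ?case using assms(2) continuous_on_subset by auto
next
  case (Suc k)
  have "Ck_on k T (dir_deriv T v f)" for v
  proof -
    have "Ck_on k T (dir_deriv S v f)" using Suc by simp
    then show ?thesis
      by (subst Ck_on_cong[of T "dir_deriv T v f" "dir_deriv S v f" k])
        (rule dir_deriv_open_subset[OF assms(1,2)])
  qed
  moreover have "f differentiable_on T"
    using Suc.prems assms(2) differentiable_on_subset by auto
  ultimately show ?case by simp
qed

lemma smooth_on_open_subset: "open T \<Longrightarrow> T \<subseteq> S \<Longrightarrow> smooth_on S f \<Longrightarrow> smooth_on T f"
  by (simp add: smooth_on_def Ck_on_open_subset)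

lemma Ck_on_imp_continuous_on: "Ck_on k S f \<Longrightarrow> continuous_on S f"
  by (cases k) (auto intro: differentiable_imp_continuous_on)

lemma smooth_on_imp_Ck_on: "smooth_on S f \<Longrightarrow> Ck_on k S f"
  by (simp add: smooth_on_def)

lemma smooth_on_imp_continuous_on: "smooth_on S f \<Longrightarrow> continuous_on S f"
  by (rule Ck_on_imp_continuous_on[OF smooth_on_imp_Ck_on])

lemma smooth_on_imp_differentiable_on: "smooth_on S f \<Longrightarrow> f differentiable_on S"
  using smooth_on_imp_Ck_on[of S f "Suc 0"] by simp

lemma smooth_on_dir_deriv:
  assumes "smooth_on S f"
  shows "smooth_on S (dir_deriv S v f)"
  unfolding smooth_on_def
proof
  show "Ck_on k S (dir_deriv S v f)" for k
    using smooth_on_imp_Ck_on[OF assms, of "Suc k"] by simp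
qed

lemma has_derivative_dir_deriv_within:
  assumes "f differentiable_on S" "x \<in> S"
  shows "(f has_derivative (\<lambda>v. dir_deriv S v f x)) (at x within S)"
  using assms frechet_derivative_works[of f "at x within S"]
  unfolding differentiable_on_def dir_deriv_def by auto

lemma has_derivative_dir_deriv:
  assumes "f differentiable_on S" "open S" "x \<in> S"
  shows "(f has_derivative (\<lambda>v. dir_deriv S v f x)) (at x)"
  using has_derivative_dir_deriv_within[OF assms(1,3)] at_within_open[OF assms(3,2)] by simp

lemma dir_deriv_eqI:
  assumes "(f has_derivative D) (at x)" "open S" "x \<in> S"
  shows "dir_deriv S v f x = D v"
  using frechet_derivative_at[OF assms(1)] at_within_open[OF assms(3,2)]
  unfolding dir_deriv_def by simp

lemma linear_dir_deriv:
  assumes "f differentiable_on S" "x \<in> S"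
  shows "linear (\<lambda>v. dir_deriv S v f x)"
  by (rule has_derivative_linear[OF has_derivative_dir_deriv_within[OF assms]])

lemma dir_deriv_scaleR:
  "f differentiable_on S \<Longrightarrow> x \<in> S \<Longrightarrow> dir_deriv S (r *\<^sub>R v) f x = r * dir_deriv S v f x"
  using linear_scale[OF linear_dir_deriv] by fastforce

lemma dir_deriv_add:
  "f differentiable_on S \<Longrightarrow> x \<in> S \<Longrightarrow> dir_deriv S (u + v) f x = dir_deriv S u f x + dir_deriv S v f x"
  using linear_add[OF linear_dir_deriv] by fastforce

lemma dir_deriv_zero: "f differentiable_on S \<Longrightarrow> x \<in> S \<Longrightarrow> dir_deriv S 0 f x = 0"
  using linear_0[OF linear_dir_deriv] by fastforce

lemma dir_deriv_sum:
  assumes "f differentiable_on S" "x \<in> S"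
  shows "dir_deriv S (\<Sum>i\<in>I. c i *\<^sub>R e i) f x = (\<Sum>i\<in>I. c i * dir_deriv S (e i) f x)"
  using linear_sum[OF linear_dir_deriv[OF assms], of "\<lambda>i. c i *\<^sub>R e i" I]
  by (simp add: dir_deriv_scaleR[OF assms])

lemma dir_deriv_eq_sum_Basis:
  fixes f :: "'a::euclidean_space \<Rightarrow> real"
  assumes "f differentiable_on S" "x \<in> S"
  shows "dir_deriv S v f x = (\<Sum>b\<in>Basis. (v \<bullet> b) * dir_deriv S b f x)"
  using dir_deriv_sum[OF assms, of "\<lambda>b. v \<bullet> b" "\<lambda>b. b" Basis]
  by (simp add: euclidean_representation)

text \<open>The inner derivative is linear in its direction at every point of \<open>S\<close>, so
  that identity can be differentiated once more.\<close>

lemma dir_deriv_dir_deriv_sum: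
  assumes "Ck_on 2 S f" "open S" "x \<in> S"
  shows "dir_deriv S v (dir_deriv S (\<Sum>i\<in>I. c i *\<^sub>R e i) f) x
    = (\<Sum>i\<in>I. c i * dir_deriv S v (dir_deriv S (e i) f) x)"
proof -
  have d: "f differentiable_on S" "\<And>u. dir_deriv S u f differentiable_on S"
    using assms(1) by (auto simp: eval_nat_numeral)
  have "dir_deriv S v (dir_deriv S (\<Sum>i\<in>I. c i *\<^sub>R e i) f) x
    = dir_deriv S v (\<lambda>y. \<Sum>i\<in>I. c i * dir_deriv S (e i) f y) x"
    by (intro dir_deriv_cong dir_deriv_sum d assms)
  also have "\<dots> = (\<Sum>i\<in>I. c i * dir_deriv S v (dir_deriv S (e i) f) x)"
    by (rule dir_deriv_eqI[OF _ assms(2,3)])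
      (intro has_derivative_sum has_derivative_mult_right has_derivative_dir_deriv d assms)
  finally show ?thesis .
qed

lemma has_real_derivative_along_line:
  assumes "f differentiable_on S" "open S" "x + r *\<^sub>R v \<in> S"
  shows "((\<lambda>s. f (x + s *\<^sub>R v)) has_real_derivative dir_deriv S v f (x + r *\<^sub>R v)) (at r)"
proof -
  have "((\<lambda>s. f (x + s *\<^sub>R v)) has_derivative (\<lambda>h. dir_deriv S (h *\<^sub>R v) f (x + r *\<^sub>R v))) (at r)"
    by (rule has_derivative_compose[where g = f and f = "\<lambda>s. x + s *\<^sub>R v"])
       (auto intro!: derivative_eq_intros has_derivative_dir_deriv assms)
  then show ?thesis
    using dir_deriv_scaleR[OF assms(1,3)] by (simp add: has_field_derivative_def mult.commute[of _ "dir_deriv S v f _"])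
qed

text \<open>The left-hand side is symmetric in \<open>u\<close> and \<open>v\<close>, so letting \<open>s\<close> tend to 0 shows that mixed
  derivatives commute.\<close>

lemma second_difference_mvt:
  assumes "Ck_on 2 S f" "open S" "ball x r \<subseteq> S" and s: "0 < s" "s * (norm u + norm v) < r"
  shows "\<exists>y\<in>ball x r. f (x + s *\<^sub>R u + s *\<^sub>R v) - f (x + s *\<^sub>R u) - f (x + s *\<^sub>R v) + f x
    = s\<^sup>2 * dir_deriv S v (dir_deriv S u f) y"
proof -
  have d: "f differentiable_on S" "\<And>u. dir_deriv S u f differentiable_on S"
    using assms(1) by (auto simp: eval_nat_numeral)
  have inb: "x + a *\<^sub>R u + b *\<^sub>R v \<in> ball x r" if "0 \<le> a" "a \<le> s" "0 \<le> b" "b \<le> s" for a b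
  proof -
    have "norm (a *\<^sub>R u + b *\<^sub>R v) \<le> a * norm u + b * norm v"
      using that by (intro norm_triangle_le) auto
    also have "\<dots> \<le> s * norm u + s * norm v"
      using that by (intro add_mono mult_right_mono) auto
    finally show ?thesis using s(2) by (simp add: dist_norm algebra_simps norm_minus_commute)
  qed
  have inS: "x + a *\<^sub>R u + b *\<^sub>R v \<in> S" if "0 \<le> a" "a \<le> s" "0 \<le> b" "b \<le> s" for a b
    using inb[OF that] assms(3) by auto
  have "\<exists>\<xi>. 0 < \<xi> \<and> \<xi> < s \<and> (f (x + s *\<^sub>R v + s *\<^sub>R u) - f (x + s *\<^sub>R u)) - (f (x + s *\<^sub>R v + 0 *\<^sub>R u) - f (x + 0 *\<^sub>R u))
    = (s - 0) * (dir_deriv S u f (x + s *\<^sub>R v + \<xi> *\<^sub>R u) - dir_deriv S u f (x + \<xi> *\<^sub>R u))"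
    using inS[of _ s] inS[of _ 0] s(1)
    by (intro MVT2 DERIV_diff has_real_derivative_along_line[OF d(1) assms(2)]) (auto simp: ac_simps)
  then obtain \<xi> where \<xi>: "0 < \<xi>" "\<xi> < s" "f (x + s *\<^sub>R u + s *\<^sub>R v) - f (x + s *\<^sub>R u) - f (x + s *\<^sub>R v) + f x
    = s * (dir_deriv S u f (x + \<xi> *\<^sub>R u + s *\<^sub>R v) - dir_deriv S u f (x + \<xi> *\<^sub>R u + 0 *\<^sub>R v))"
    by (auto simp: algebra_simps)
  have "\<exists>\<eta>. 0 < \<eta> \<and> \<eta> < s \<and> dir_deriv S u f (x + \<xi> *\<^sub>R u + s *\<^sub>R v) - dir_deriv S u f (x + \<xi> *\<^sub>R u + 0 *\<^sub>R v)
     = (s - 0) * dir_deriv S v (dir_deriv S u f) (x + \<xi> *\<^sub>R u + \<eta> *\<^sub>R v)"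
    using inS[of \<xi>] s(1) \<xi>
    by (intro MVT2 has_real_derivative_along_line[OF d(2) assms(2)]) auto
  then obtain \<eta> where "0 < \<eta>" "\<eta> < s" "dir_deriv S u f (x + \<xi> *\<^sub>R u + s *\<^sub>R v) - dir_deriv S u f (x + \<xi> *\<^sub>R u + 0 *\<^sub>R v)
     = s * dir_deriv S v (dir_deriv S u f) (x + \<xi> *\<^sub>R u + \<eta> *\<^sub>R v)"
    by auto
  then show ?thesis
    using \<xi> inb[of \<xi> \<eta>] by (intro bexI[of _ "x + \<xi> *\<^sub>R u + \<eta> *\<^sub>R v"]) (auto simp: power2_eq_square)
qed

lemma dir_deriv_commute:
  assumes "Ck_on 2 S f" "open S" "x \<in> S"
  shows "dir_deriv S v (dir_deriv S u f) x = dir_deriv S u (dir_deriv S v f) x"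
proof (rule ccontr)
  define g h where "g = dir_deriv S v (dir_deriv S u f)" and "h = dir_deriv S u (dir_deriv S v f)"
  assume "dir_deriv S v (dir_deriv S u f) x \<noteq> dir_deriv S u (dir_deriv S v f) x"
  \<comment> \<open>Values closer than half this distance to \<open>g x\<close> and
    \<open>h x\<close> cannot coincide, yet the common second difference will force
    \<open>g y = h z\<close>.\<close>
  then have pos: "dist (g x) (h x) / 2 > 0" by (simp add: g_def h_def)
  have "continuous_on S g" "continuous_on S h"
    using assms(1) unfolding g_def h_def by (auto simp: eval_nat_numeral)
  then have "isCont g x" "isCont h x"
    using assms continuous_on_eq_continuous_at by blast+
  then obtain d1 d2 where d: "d1 > 0" "d2 > 0" "\<And>y. dist y x < d1 \<Longrightarrow> dist (g y) (g x) < dist (g x) (h x) / 2"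
    "\<And>y. dist y x < d2 \<Longrightarrow> dist (h y) (h x) < dist (g x) (h x) / 2"
    unfolding continuous_at_eps_delta using pos by metis
  obtain d3 where d3: "d3 > 0" "ball x d3 \<subseteq> S"
    using assms open_contains_ball by blast
  define r where "r = min d1 (min d2 d3)"
  have r: "r > 0" "ball x r \<subseteq> S" using d d3 by (auto simp: r_def)
  \<comment> \<open>The factor 2 keeps the parallelogram strictly inside the ball; the summand 1
    covers \<open>u = v = 0\<close>.\<close>
  define s where "s = r / (2 * (norm u + norm v + 1))"
  have np: "norm u + norm v + 1 > 0" by (smt (verit) norm_ge_zero)
  have s: "s > 0" using r np unfolding s_def by simp
  have "s * (norm u + norm v) \<le> s * (norm u + norm v + 1)" using s by (simp add: algebra_simps)
  also have "\<dots> = r / 2" using np by (simp add: s_def field_simps)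
  also have "\<dots> < r" using r by simp
  finally have sr: "s * (norm u + norm v) < r" .
  obtain y where y: "y \<in> ball x r" "f (x + s *\<^sub>R u + s *\<^sub>R v) - f (x + s *\<^sub>R u) - f (x + s *\<^sub>R v) + f x = s\<^sup>2 * g y"
    using second_difference_mvt[OF assms(1,2) r(2) s sr] by (auto simp: g_def)
  obtain z where z: "z \<in> ball x r" "f (x + s *\<^sub>R v + s *\<^sub>R u) - f (x + s *\<^sub>R v) - f (x + s *\<^sub>R u) + f x = s\<^sup>2 * h z"
    using second_difference_mvt[OF assms(1,2) r(2) s, of v u] sr by (auto simp: h_def add.commute)
  have "s\<^sup>2 * g y = s\<^sup>2 * h z"
    using y(2) z(2) by (simp add: algebra_simps)
  then have "g y = h z" using s by simp
  moreover have "dist (g y) (g x) < dist (g x) (h x) / 2" "dist (h z) (h x) < dist (g x) (h x) / 2"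
    using y(1) z(1) d(3)[of y] d(4)[of z] by (auto simp: r_def dist_commute)
  ultimately show False by (auto simp: dist_real_def abs_if split: if_splits)
qed

section \<open>Second-order jets of curves\<close>

text \<open>First and second derivative of a curve at 0. The first derivative exists on a full
  neighbourhood, as \<open>nhds 0\<close> contains 0, the second is required at 0 only; the
  derivative curve itself stays hidden.\<close>

definition has_jet2 :: "(real \<Rightarrow> 'b::real_normed_vector) \<Rightarrow> 'b \<Rightarrow> 'b \<Rightarrow> bool" where
  "has_jet2 f d1 d2 \<longleftrightarrow> (\<exists>g. (\<forall>\<^sub>F s in nhds 0. (f has_vector_derivative g s) (at s)) \<and> g 0 = d1 \<and>
     (g has_vector_derivative d2) (at 0))"

lemma has_jet2I:
  assumes "\<forall>\<^sub>F s in nhds 0. (f has_vector_derivative g s) (at s)" "g 0 = d1"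
    "(g has_vector_derivative d2) (at 0)"
  shows "has_jet2 f d1 d2"
  using assms unfolding has_jet2_def by (intro exI conjI)

lemma has_jet2E:
  assumes "has_jet2 f d1 d2"
  obtains g where "\<forall>\<^sub>F s in nhds 0. (f has_vector_derivative g s) (at s)" "g 0 = d1"
    "(g has_vector_derivative d2) (at 0)" "(f has_vector_derivative d1) (at 0)"
proof -
  from assms obtain g where g: "\<forall>\<^sub>F s in nhds 0. (f has_vector_derivative g s) (at s)" "g 0 = d1"
    "(g has_vector_derivative d2) (at 0)"
    unfolding has_jet2_def by (elim exE conjE)
  show thesis
    using that[OF g] eventually_nhds_x_imp_x[OF g(1)] g(2) by simp
qed

lemma has_jet2_const: "has_jet2 (\<lambda>_. c) 0 0"
  by (rule has_jet2I[where g = "\<lambda>_. 0"]) auto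

lemma has_jet2_add:
  assumes "has_jet2 f a b" "has_jet2 g c d"
  shows "has_jet2 (\<lambda>s. f s + g s) (a + c) (b + d)"
proof -
  from assms obtain f' g' where
    ev: "\<forall>\<^sub>F s in nhds 0. (f has_vector_derivative f' s) (at s)" "\<forall>\<^sub>F s in nhds 0. (g has_vector_derivative g' s) (at s)" and
    fg: "f' 0 = a" "(f' has_vector_derivative b) (at 0)"  "g' 0 = c" "(g' has_vector_derivative d) (at 0)"
    by (auto elim!: has_jet2E)
  from ev have "\<forall>\<^sub>F s in nhds 0. ((\<lambda>s. f s + g s) has_vector_derivative f' s + g' s) (at s)"
    by eventually_elim (rule has_vector_derivative_add)
  then show ?thesis
    by (rule has_jet2I) (use fg in \<open>auto intro: has_vector_derivative_add\<close>)
qed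

lemma has_jet2_sum:
  assumes "\<And>i. i \<in> I \<Longrightarrow> has_jet2 (f i) (a i) (b i)"
  shows "has_jet2 (\<lambda>s. \<Sum>i\<in>I. f i s) (\<Sum>i\<in>I. a i) (\<Sum>i\<in>I. b i)"
  using assms by (induction I rule: infinite_finite_induct) (auto intro: has_jet2_const has_jet2_add)

lemma has_jet2_bounded_linear:
  assumes "bounded_linear L" "has_jet2 f a b"
  shows "has_jet2 (\<lambda>s. L (f s)) (L a) (L b)"
proof -
  from assms(2) obtain f' where
    "\<forall>\<^sub>F s in nhds 0. (f has_vector_derivative f' s) (at s)" "f' 0 = a" "(f' has_vector_derivative b) (at 0)"
    by (auto elim!: has_jet2E)
  then show ?thesis
    by (intro has_jet2I[where g = "\<lambda>s. L (f' s)"])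
       (auto elim!: eventually_mono intro: bounded_linear.has_vector_derivative[OF assms(1)])
qed

text \<open>Leibniz rule to second order, in bilinear form so that it serves products and inner
  products alike.\<close>

lemma has_jet2_bounded_bilinear:
  assumes "bounded_bilinear B" "has_jet2 f a b" "has_jet2 g c d"
  shows "has_jet2 (\<lambda>s. B (f s) (g s)) (B (f 0) c + B a (g 0)) (B (f 0) d + B a c + (B a c + B b (g 0)))"
proof -
  from assms(2,3) obtain f' g' where
    f: "\<forall>\<^sub>F s in nhds 0. (f has_vector_derivative f' s) (at s)" "f' 0 = a" "(f' has_vector_derivative b) (at 0)"
      "(f has_vector_derivative a) (at 0)" and
    g: "\<forall>\<^sub>F s in nhds 0. (g has_vector_derivative g' s) (at s)" "g' 0 = c" "(g' has_vector_derivative d) (at 0)"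
      "(g has_vector_derivative c) (at 0)"
    by (auto elim!: has_jet2E)
  have ev: "\<forall>\<^sub>F s in nhds 0. ((\<lambda>s. B (f s) (g s)) has_vector_derivative B (f s) (g' s) + B (f' s) (g s)) (at s)"
    using f(1) g(1) by eventually_elim (rule bounded_bilinear.has_vector_derivative[OF assms(1)])
  have "((\<lambda>s. B (f s) (g' s) + B (f' s) (g s)) has_vector_derivative
      (B (f 0) d + B a (g' 0) + (B (f' 0) c + B b (g 0)))) (at 0)"
    by (intro has_vector_derivative_add bounded_bilinear.has_vector_derivative[OF assms(1)] f g)
  then show ?thesis
    by (intro has_jet2I[OF ev]) (auto simp: f(2) g(2))
qed

lemma has_jet2_mult:
  fixes f g :: "real \<Rightarrow> real"
  assumes "has_jet2 f a b" "has_jet2 g c d"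
  shows "has_jet2 (\<lambda>s. f s * g s) (f 0 * c + a * g 0) (f 0 * d + 2 * a * c + b * g 0)"
  using has_jet2_bounded_bilinear[OF bounded_bilinear_mult assms] by (simp add: algebra_simps)

lemma has_jet2_cmult:
  fixes f :: "real \<Rightarrow> real"
  shows "has_jet2 f a b \<Longrightarrow> has_jet2 (\<lambda>s. c * f s) (c * a) (c * b)"
  by (rule has_jet2_bounded_linear[OF bounded_linear_mult_right])

lemma has_jet2_ident: "has_jet2 (\<lambda>s. s) (1::real) 0"
  by (rule has_jet2I[where g = "\<lambda>_. 1"]) (auto intro!: has_vector_derivative_id)

text \<open>Needed because the flow equation holds only while a line stays in the open set. Equality
  near 0 is also equality near each \<open>s\<close> close to 0, so derivatives transfer at those
  points.\<close>

lemma has_jet2_cong: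
  assumes "\<forall>\<^sub>F s in nhds 0. f s = g s" "has_jet2 f a b"
  shows "has_jet2 g a b"
proof -
  from assms(2) obtain f' where
    f: "\<forall>\<^sub>F s in nhds 0. (f has_vector_derivative f' s) (at s)" "f' 0 = a" "(f' has_vector_derivative b) (at 0)"
    by (auto elim!: has_jet2E)
  have "\<forall>\<^sub>F s in nhds 0. \<forall>\<^sub>F t in nhds s. f t = g t"
    using assms(1) by (simp add: eventually_eventually)
  with f(1) have "\<forall>\<^sub>F s in nhds 0. (g has_vector_derivative f' s) (at s)"
  proof eventually_elim
    case (elim s)
    then show ?case
      using has_vector_derivative_cong_ev[where S = UNIV and f = f and g = g and x = s and f' = "f' s"] eventually_nhds_x_imp_x[OF elim(2)]
      by simp
  qed
  then show ?thesis by (rule has_jet2I) (fact f)+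
qed

text \<open>Allows two computations of the second derivative of one curve to be equated.\<close>

lemma has_jet2_unique:
  assumes "has_jet2 f a b" "has_jet2 f c d"
  shows "a = c" "b = d"
proof -
  from assms obtain f' g' where
    f: "\<forall>\<^sub>F s in nhds 0. (f has_vector_derivative f' s) (at s)" "f' 0 = a" "(f' has_vector_derivative b) (at 0)" and
    g: "\<forall>\<^sub>F s in nhds 0. (f has_vector_derivative g' s) (at s)" "g' 0 = c" "(g' has_vector_derivative d) (at 0)"
    by (auto elim!: has_jet2E)
  have ev: "\<forall>\<^sub>F s in nhds 0. f' s = g' s"
    using f(1) g(1) by eventually_elim (rule vector_derivative_unique_at)
  then show "a = c"
    using eventually_nhds_x_imp_x[OF ev] f(2) g(2) by simp
  have "(g' has_vector_derivative b) (at 0)"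
    using f(3) has_vector_derivative_cong_ev[where S = UNIV and f = f' and g = g' and x = 0 and f' = b] ev eventually_nhds_x_imp_x[OF ev] by simp
  then show "b = d"
    using g(3) by (rule vector_derivative_unique_at)
qed

text \<open>Second derivative test: \<open>g\<close> vanishes at 0, so \<open>b < 0\<close> would
  make it negative just to the right, and \<open>f\<close> would decrease strictly there.\<close>

lemma has_jet2_local_min:
  fixes f :: "real \<Rightarrow> real"
  assumes "has_jet2 f a b" and ge: "\<forall>\<^sub>F s in nhds 0. f 0 \<le> f s"
  shows "a = 0" "b \<ge> 0"
proof -
  from assms(1) obtain g where g: "\<forall>\<^sub>F s in nhds 0. (f has_real_derivative g s) (at s)" "g 0 = a"
    "(g has_real_derivative b) (at 0)" "(f has_real_derivative a) (at 0)"
    by (auto elim!: has_jet2E simp: has_real_derivative_iff_has_vector_derivative)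
  obtain d where d: "d > 0" "\<And>s. \<bar>s\<bar> < d \<Longrightarrow> (f has_real_derivative g s) (at s) \<and> f 0 \<le> f s"
    using eventually_conj[OF g(1) ge] by (auto simp: eventually_nhds_metric)
  show "a = 0"
    by (rule DERIV_local_min[OF g(4) d(1)]) (use d(2) in auto)
  show "b \<ge> 0"
  proof (rule ccontr)
    assume "\<not> b \<ge> 0"
    then obtain e where e: "e > 0" "\<And>h. 0 < h \<Longrightarrow> h < e \<Longrightarrow> g h < g 0"
      using DERIV_neg_dec_right[OF g(3)] by auto
    define h where "h = min d e / 2"
    have h: "0 < h" "h < d" "h < e" using d e by (auto simp: h_def)
    have "f 0 > f h"
    proof (rule DERIV_neg_imp_decreasing_open[OF h(1)])
      show "\<exists>y. (f has_real_derivative y) (at x) \<and> y < 0" if "0 < x" "x < h" for x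
        using d(2)[of x] e(2)[of x] h that g(2) \<open>a = 0\<close> by auto
      show "continuous_on {0..h} f"
        by (rule DERIV_continuous_on[where D = g]) (use d(2) h in \<open>auto intro: has_field_derivative_at_within\<close>)
    qed
    then show False using d(2)[of h] h by auto
  qed
qed

lemma eventually_line_in_open:
  fixes x :: "'a::real_normed_vector"
  assumes "open S" "x \<in> S"
  shows "\<forall>\<^sub>F s in nhds 0. x + s *\<^sub>R v \<in> S"
proof -
  have "((\<lambda>s. x + s *\<^sub>R v) \<longlongrightarrow> x + 0 *\<^sub>R v) (nhds 0)"
    by (intro tendsto_intros filterlim_ident)
  then show ?thesis
    by (rule topological_tendstoD) (use assms in auto)
qed

lemma has_jet2_along_line:
  assumes "Ck_on 2 S f" "open S" "x \<in> S"
  shows "has_jet2 (\<lambda>s. f (x + s *\<^sub>R v)) (dir_deriv S v f x) (dir_deriv S v (dir_deriv S v f) x)"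
proof -
  have d: "f differentiable_on S" "\<And>u. dir_deriv S u f differentiable_on S"
    using assms(1) by (auto simp: eval_nat_numeral)
  have ev': "\<forall>\<^sub>F s in nhds 0. ((\<lambda>s. f (x + s *\<^sub>R v)) has_vector_derivative dir_deriv S v f (x + s *\<^sub>R v)) (at s)"
    using eventually_line_in_open[OF assms(2,3), of v] by (rule eventually_mono)
      (auto simp: has_real_derivative_along_line[OF d(1) assms(2)] has_real_derivative_iff_has_vector_derivative[symmetric])
  show ?thesis
    by (rule has_jet2I[OF ev'])
       (use has_real_derivative_along_line[OF d(2) assms(2), of x 0 v v] assms(3)
         in \<open>auto simp: has_real_derivative_iff_has_vector_derivative\<close>)
qed

text \<open>Second-order chain rule. Expanding the velocity of \<open>q\<close> in the basis turns
  the moving direction into scalar coefficients, to which the product rule applies.\<close>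

lemma has_jet2_compose:
  fixes q :: "real \<Rightarrow> 'a::euclidean_space"
  assumes F: "Ck_on 2 UNIV F" and q: "has_jet2 q q1 q2"
  shows "has_jet2 (\<lambda>s. F (q s)) (dir_deriv UNIV q1 F (q 0))
    (dir_deriv UNIV q1 (dir_deriv UNIV q1 F) (q 0) + dir_deriv UNIV q2 F (q 0))"
proof -
  have d: "F differentiable_on UNIV" "\<And>u. dir_deriv UNIV u F differentiable_on UNIV"
    using F by (auto simp: eval_nat_numeral)
  from q obtain q' where
    q': "\<forall>\<^sub>F s in nhds 0. (q has_vector_derivative q' s) (at s)" "q' 0 = q1" "(q' has_vector_derivative q2) (at 0)"
      "(q has_vector_derivative q1) (at 0)"
    by (auto elim!: has_jet2E)
  have chain: "((\<lambda>s. G (q s)) has_vector_derivative dir_deriv UNIV v G (q s)) (at s)"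
    if "G differentiable_on UNIV" "(q has_vector_derivative v) (at s)" for G v s
    using vector_derivative_diff_chain_within[OF that(2) has_derivative_at_withinI[OF has_derivative_dir_deriv[OF that(1) open_UNIV UNIV_I]]]
    by (simp add: o_def)
  have ev: "\<forall>\<^sub>F s in nhds 0. ((\<lambda>s. F (q s)) has_vector_derivative
      (\<Sum>b\<in>Basis. (q' s \<bullet> b) * dir_deriv UNIV b F (q s))) (at s)"
    using q'(1)
  proof eventually_elim
    case (elim s)
    show ?case using chain[OF d(1) elim] dir_deriv_eq_sum_Basis[OF d(1), of "q s" "q' s"] by simp
  qed
  have "((\<lambda>s. \<Sum>b\<in>Basis. (q' s \<bullet> b) * dir_deriv UNIV b F (q s)) has_vector_derivative
      (\<Sum>b\<in>Basis. (q' 0 \<bullet> b) * dir_deriv UNIV q1 (dir_deriv UNIV b F) (q 0) + (q2 \<bullet> b) * dir_deriv UNIV b F (q 0))) (at 0)"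
    by (intro has_vector_derivative_sum has_vector_derivative_mult chain d q'
        bounded_linear.has_vector_derivative[OF bounded_linear_inner_left])
  also have "(\<Sum>b\<in>Basis. (q' 0 \<bullet> b) * dir_deriv UNIV q1 (dir_deriv UNIV b F) (q 0) + (q2 \<bullet> b) * dir_deriv UNIV b F (q 0))
     = dir_deriv UNIV q1 (dir_deriv UNIV (\<Sum>b\<in>Basis. (q1 \<bullet> b) *\<^sub>R b) F) (q 0) + dir_deriv UNIV q2 F (q 0)"
    unfolding sum.distrib q'(2) dir_deriv_dir_deriv_sum[OF F open_UNIV UNIV_I]
    using dir_deriv_eq_sum_Basis[OF d(1), of "q 0" q2] by simp
  finally show ?thesis
    using dir_deriv_eq_sum_Basis[OF d(1), of "q 0" q1] q'(2)
    by (intro has_jet2I[OF ev]) (auto simp: euclidean_representation)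
qed

lemma has_jet2_vec:
  fixes f :: "'n::finite \<Rightarrow> real \<Rightarrow> real"
  assumes "\<And>k. has_jet2 (f k) (a k) (b k)"
  shows "has_jet2 (\<lambda>s. \<chi> k. f k s) (\<chi> k. a k) (\<chi> k. b k)"
proof -
  have eq: "(\<chi> k. g k) = (\<Sum>k\<in>UNIV. g k *\<^sub>R axis k (1::real))" for g :: "'n \<Rightarrow> real"
    using basis_expansion[of "\<chi> k. g k"] by (simp add: scalar_mult_eq_scaleR)
  show ?thesis
    unfolding eq by (intro has_jet2_sum has_jet2_bounded_linear[OF bounded_linear_scaleR_left] assms)
qed

section \<open>Derivatives of powers of the norm\<close>

lemma has_derivative_norm_powr_nonzero:
  fixes v :: "'a::real_inner"
  assumes "v \<noteq> 0"
  shows "((\<lambda>v. norm v powr p) has_derivative (\<lambda>h. p * norm v powr (p - 2) * (v \<bullet> h))) (at v)"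
proof -
  have eq: "norm v powr (p - 2) * norm v = norm v powr (p - 1)"
    using assms powr_add[of "norm v" "p - 2" 1] by simp
  have "((\<lambda>v. norm v powr p) has_derivative (\<lambda>h. (h \<bullet> sgn v) * (p * norm v powr (p - 1)))) (at v)"
    using assms has_real_derivative_powr[of "norm v" p]
    by (intro has_derivative_compose[OF has_derivative_norm[OF assms], where g = "\<lambda>x. x powr p"])
       (auto simp: has_field_derivative_def mult.commute[of _ "p * _"])
  also have "(\<lambda>h. (h \<bullet> sgn v) * (p * norm v powr (p - 1))) = (\<lambda>h. p * norm v powr (p - 2) * (v \<bullet> h))"
    unfolding eq[symmetric] using assms by (auto simp: sgn_div_norm inner_commute field_simps)
  finally show ?thesis .
qed

text \<open>At the origin the difference quotient is \<open>norm h powr (p - 1)\<close>, which tends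
  to 0 because \<open>p > 1\<close>.\<close>

lemma has_derivative_norm_powr:
  fixes v :: "'a::real_inner"
  assumes "p > 1"
  shows "((\<lambda>v. norm v powr p) has_derivative (\<lambda>h. p * norm v powr (p - 2) * (v \<bullet> h))) (at v)"
proof (cases "v = 0")
  case True
  have "((\<lambda>h::'a. norm h powr (p - 1)) \<longlongrightarrow> norm (0::'a) powr (p - 1)) (at 0)"
    using assms by (intro tendsto_intros) auto
  moreover have "\<forall>\<^sub>F h in at 0. norm h powr (p - 1) = norm (norm (0 + h) powr p - norm (0::'a) powr p - 0) / norm (h::'a)"
    by (rule eventually_at_topological[THEN iffD2]) (auto intro!: exI[of _ UNIV] simp: powr_diff)
  ultimately have "((\<lambda>h::'a. norm (norm (0 + h) powr p - norm (0::'a) powr p - 0) / norm h) \<longlongrightarrow> 0) (at 0)"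
    by (auto elim: Lim_transform_eventually)
  then show ?thesis
    unfolding has_derivative_at using True by simp
qed (rule has_derivative_norm_powr_nonzero)

text \<open>Where one factor vanishes, continuity of the other suffices. This serves
  \<open>norm (q s) powr (p - 2)\<close>, which may fail to be differentiable at a zero of
  \<open>q\<close>.\<close>

lemma has_real_derivative_mult_at_zero:
  fixes h k :: "real \<Rightarrow> real"
  assumes "isCont h 0" "(k has_real_derivative K) (at 0)" "k 0 = 0"
  shows "((\<lambda>s. h s * k s) has_real_derivative h 0 * K) (at 0)"
proof -
  have "((\<lambda>s. h s * ((k (0 + s) - k 0) / s)) \<longlongrightarrow> h 0 * K) (at 0)"
    using assms(1,2) unfolding isCont_def DERIV_def by (intro tendsto_mult)
  then show ?thesis
    unfolding DERIV_def using assms(3) by simp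
qed

text \<open>The bounds are wasteful on purpose: unlike \<open>norm v powr (p - 2)\<close>, which vanishes at \<open>v = 0\<close>
  even for \<open>p = 2\<close>, the majorant is continuous in \<open>v\<close>.\<close>

lemma has_jet2_norm_powr:
  fixes q :: "real \<Rightarrow> 'a::real_inner"
  assumes p: "p \<ge> 2" and q: "has_jet2 q q1 0"
  shows "\<exists>N1 N2. has_jet2 (\<lambda>s. norm (q s) powr p) N1 N2 \<and>
    \<bar>N1\<bar> \<le> p * (1 + norm (q 0)) powr p * norm q1 \<and>
    \<bar>N2\<bar> \<le> p\<^sup>2 * (1 + norm (q 0)) powr p * (norm q1)\<^sup>2"
proof -
  let ?M = "(1 + norm (q 0)) powr p"
  have M: "norm (q 0) powr (p - 2) * norm (q 0) \<le> ?M" "norm (q 0) powr (p - 2) \<le> ?M" "1 \<le> ?M" "norm (q 0) \<le> ?M"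
  proof -
    show 1: "1 \<le> ?M" using p by (intro ge_one_powr_ge_zero) auto
    have "norm (q 0) powr (p - 2) \<le> (1 + norm (q 0)) powr (p - 2)" "norm (q 0) \<le> (1 + norm (q 0)) powr 1"
      using p by (auto intro!: powr_mono2)
    then have "norm (q 0) powr (p - 2) * norm (q 0) \<le> (1 + norm (q 0)) powr (p - 2) * (1 + norm (q 0)) powr 1"
      by (intro mult_mono) auto
    also have "\<dots> = (1 + norm (q 0)) powr (p - 1)"
      using powr_add[of "1 + norm (q 0)" "p - 2" 1] by simp
    also have "\<dots> \<le> ?M" by (intro powr_mono) auto
    finally show "norm (q 0) powr (p - 2) * norm (q 0) \<le> ?M" .
    have "norm (q 0) powr (p - 2) \<le> (1 + norm (q 0)) powr (p - 2)" using p by (auto intro!: powr_mono2)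
    also have "\<dots> \<le> ?M" by (intro powr_mono) auto
    finally show "norm (q 0) powr (p - 2) \<le> ?M" .
    have "norm (q 0) \<le> (1 + norm (q 0)) powr 1" by auto
    also have "\<dots> \<le> ?M" using p by (intro powr_mono) auto
    finally show "norm (q 0) \<le> ?M" .
  qed
  have inner_le: "\<bar>q 0 \<bullet> q1\<bar> \<le> norm (q 0) * norm q1" by (rule Cauchy_Schwarz_ineq2)
  from q obtain q' where
    q': "\<forall>\<^sub>F s in nhds 0. (q has_vector_derivative q' s) (at s)" "q' 0 = q1" "(q' has_vector_derivative 0) (at 0)"
      "(q has_vector_derivative q1) (at 0)"
    by (auto elim!: has_jet2E)
  show ?thesis
  \<comment> \<open>For \<open>p = 2\<close> the power is the inner product of \<open>q\<close> with
    itself. The general formula would contain \<open>norm (q s) powr 0\<close>, which is 0 instead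
    of 1 at a zero of \<open>q\<close>.\<close>
  proof (cases "p = 2")
    case True
    have "has_jet2 (\<lambda>s. norm (q s) powr p) (2 * (q 0 \<bullet> q1)) (2 * (norm q1)\<^sup>2)"
      using has_jet2_bounded_bilinear[OF bounded_bilinear_inner q q] True
      by (simp add: powr_numeral power2_norm_eq_inner inner_commute)
    moreover have "\<bar>2 * (q 0 \<bullet> q1)\<bar> \<le> p * ?M * norm q1"
    proof -
      have "\<bar>2 * (q 0 \<bullet> q1)\<bar> = 2 * \<bar>q 0 \<bullet> q1\<bar>" by (simp add: abs_mult)
      also have "\<dots> \<le> 2 * (?M * norm q1)"
        using inner_le mult_right_mono[OF M(4) norm_ge_zero[of q1]] by linarith
      also have "\<dots> = p * ?M * norm q1" by (simp only: True mult.assoc)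
      finally show ?thesis .
    qed
    moreover have "\<bar>2 * (norm q1)\<^sup>2\<bar> \<le> p\<^sup>2 * ?M * (norm q1)\<^sup>2"
    proof -
      have "\<bar>2 * (norm q1)\<^sup>2\<bar> = 2 * (1 * (norm q1)\<^sup>2)" by simp
      also have "\<dots> \<le> 4 * (?M * (norm q1)\<^sup>2)"
        by (intro mult_mono mult_right_mono M) auto
      also have "\<dots> = p\<^sup>2 * ?M * (norm q1)\<^sup>2" by (simp only: True mult.assoc) simp
      finally show ?thesis .
    qed
    ultimately show ?thesis by blast
  next
    case False
    then have p2: "p > 2" using p by simp
    have ev: "\<forall>\<^sub>F s in nhds 0. ((\<lambda>s. norm (q s) powr p) has_vector_derivative
        p * (norm (q s) powr (p - 2) * (q s \<bullet> q' s))) (at s)"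
      using q'(1)
    proof eventually_elim
      case (elim s)
      have "p > 1" using p2 by simp
      from vector_derivative_diff_chain_within[OF elim has_derivative_at_withinI[OF has_derivative_norm_powr[OF this]]]
      show ?case by (simp add: o_def mult.assoc)
    qed
    have inner': "((\<lambda>s. q s \<bullet> q' s) has_real_derivative (q1 \<bullet> q1)) (at 0)"
      using bounded_bilinear.has_vector_derivative[OF bounded_bilinear_inner q'(4) q'(3)] q'(2)
      by (simp add: has_real_derivative_iff_has_vector_derivative)
    have "\<exists>D. ((\<lambda>s. norm (q s) powr (p - 2) * (q s \<bullet> q' s)) has_real_derivative D) (at 0) \<and>
        \<bar>D\<bar> \<le> (p - 1) * ?M * (norm q1)\<^sup>2"
    \<comment> \<open>If \<open>q 0 = 0\<close>, the inner product vanishes and its coefficient is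
      continuous with value 0, as \<open>p > 2\<close>; hence \<open>D = 0\<close>. Otherwise the
      product rule applies.\<close>
    proof (cases "q 0 = 0")
      case True
      have "isCont q 0" using q'(4) has_vector_derivative_continuous by blast
      then have "isCont (\<lambda>s. norm (q s) powr (p - 2)) 0"
        unfolding isCont_def using p2 by (intro tendsto_powr2 tendsto_norm tendsto_const) auto
      from has_real_derivative_mult_at_zero[OF this inner'] show ?thesis
        using True p2 by (intro exI[of _ 0]) auto
    next
      case nz: False
      define D where "D = (p - 2) * norm (q 0) powr (p - 4) * (q 0 \<bullet> q1)\<^sup>2 + norm (q 0) powr (p - 2) * (q1 \<bullet> q1)"
      have "((\<lambda>s. norm (q s) powr (p - 2)) has_real_derivative (p - 2) * norm (q 0) powr (p - 4) * (q 0 \<bullet> q1)) (at 0)"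
        using vector_derivative_diff_chain_within[OF q'(4) has_derivative_at_withinI[OF has_derivative_norm_powr_nonzero[OF nz, of "p - 2"]]]
        by (simp add: o_def has_real_derivative_iff_has_vector_derivative)
      from DERIV_mult[OF this inner'] have "((\<lambda>s. norm (q s) powr (p - 2) * (q s \<bullet> q' s)) has_real_derivative D) (at 0)"
        by (simp add: D_def q'(2) power2_eq_square algebra_simps)
      moreover have "0 \<le> D" unfolding D_def using p2 by (intro add_nonneg_nonneg mult_nonneg_nonneg) auto
      moreover have "D \<le> (p - 1) * ?M * (norm q1)\<^sup>2"
      proof -
        have "(q 0 \<bullet> q1)\<^sup>2 \<le> (norm (q 0) * norm q1)\<^sup>2"
          using power_mono[OF inner_le, of 2] by simp
        then have "norm (q 0) powr (p - 4) * (q 0 \<bullet> q1)\<^sup>2 \<le> norm (q 0) powr (p - 4) * ((norm (q 0) powr 2) * (norm q1)\<^sup>2)"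
          by (intro mult_left_mono) (auto simp: power_mult_distrib powr_numeral)
        also have "\<dots> = norm (q 0) powr (p - 2) * (norm q1)\<^sup>2"
          using powr_add[of "norm (q 0)" "p - 4" 2] by (simp add: mult.assoc[symmetric])
        finally have "(p - 2) * (norm (q 0) powr (p - 4) * (q 0 \<bullet> q1)\<^sup>2) \<le> (p - 2) * (norm (q 0) powr (p - 2) * (norm q1)\<^sup>2)"
          using p2 by (intro mult_left_mono) auto
        then have "D \<le> (p - 1) * (norm (q 0) powr (p - 2) * (norm q1)\<^sup>2)"
          unfolding D_def power2_norm_eq_inner by (simp add: algebra_simps)
        also have "\<dots> \<le> (p - 1) * (?M * (norm q1)\<^sup>2)"
          using p2 M by (intro mult_left_mono mult_right_mono) auto
        finally show ?thesis by (simp add: mult.assoc)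
      qed
      ultimately show ?thesis by auto
    qed
    then obtain D where D: "((\<lambda>s. norm (q s) powr (p - 2) * (q s \<bullet> q' s)) has_real_derivative D) (at 0)"
        "\<bar>D\<bar> \<le> (p - 1) * ?M * (norm q1)\<^sup>2" by blast
    have "has_jet2 (\<lambda>s. norm (q s) powr p) (p * (norm (q 0) powr (p - 2) * (q 0 \<bullet> q1))) (p * D)"
      by (rule has_jet2I[OF ev])
         (use DERIV_cmult[OF D(1), of p] q'(2) in \<open>auto simp: has_real_derivative_iff_has_vector_derivative\<close>)
    moreover have "\<bar>p * (norm (q 0) powr (p - 2) * (q 0 \<bullet> q1))\<bar> \<le> p * ?M * norm q1"
    proof -
      have "\<bar>p * (norm (q 0) powr (p - 2) * (q 0 \<bullet> q1))\<bar> = p * (norm (q 0) powr (p - 2) * \<bar>q 0 \<bullet> q1\<bar>)"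
        using p2 by (simp add: abs_mult)
      also have "\<dots> \<le> p * (norm (q 0) powr (p - 2) * (norm (q 0) * norm q1))"
        using p2 inner_le by (intro mult_left_mono) auto
      also have "\<dots> = p * ((norm (q 0) powr (p - 2) * norm (q 0)) * norm q1)" by simp
      also have "\<dots> \<le> p * (?M * norm q1)"
        using p2 M by (intro mult_left_mono mult_right_mono) auto
      finally show ?thesis by (simp add: mult.assoc)
    qed
    moreover have "\<bar>p * D\<bar> \<le> p\<^sup>2 * ?M * (norm q1)\<^sup>2"
    proof -
      have "\<bar>p * D\<bar> = p * \<bar>D\<bar>" using p2 by (simp add: abs_mult)
      also have "\<dots> \<le> p * (p * ?M * (norm q1)\<^sup>2)"
      proof (rule mult_left_mono)
        have "(p - 1) * (?M * (norm q1)\<^sup>2) \<le> p * (?M * (norm q1)\<^sup>2)"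
          by (intro mult_right_mono) auto
        then show "\<bar>D\<bar> \<le> p * ?M * (norm q1)\<^sup>2" using D(2) by (simp add: mult.assoc)
      qed (use p2 in simp)
      finally show ?thesis by (simp add: power2_eq_square mult.assoc)
    qed
    ultimately show ?thesis by blast
  qed
qed

section \<open>The evolution of second derivatives at a minimum\<close>

text \<open>The induction splits off one rank-one term of \<open>H\<close> per index, as in a Cholesky decomposition.\<close>

lemma trace_product_nonneg:
  fixes A H :: "'i \<Rightarrow> 'i \<Rightarrow> real"
  assumes "finite I" "\<And>x. (\<Sum>i\<in>I. \<Sum>j\<in>I. A i j * x i * x j) \<ge> 0"
    "\<And>x. (\<Sum>i\<in>I. \<Sum>j\<in>I. H i j * x i * x j) \<ge> 0" "\<And>i j. H i j = H j i"
  shows "(\<Sum>i\<in>I. \<Sum>j\<in>I. A i j * H i j) \<ge> 0"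
  using assms
proof (induction I arbitrary: H rule: finite_induct)
  case (insert k I)
  let ?h = "\<lambda>j. H k j"
  have expand: "(\<Sum>i\<in>insert k I. \<Sum>j\<in>insert k I. B i j) =
      B k k + (\<Sum>j\<in>I. B k j) + (\<Sum>i\<in>I. B i k) + (\<Sum>i\<in>I. \<Sum>j\<in>I. B i j)" for B :: "'i \<Rightarrow> 'i \<Rightarrow> real"
    using insert.hyps by (simp add: sum.distrib algebra_simps)
  have upd: "(\<Sum>i\<in>I. \<Sum>j\<in>I. B i j * (x(k := c)) i * (x(k := c)) j) = (\<Sum>i\<in>I. \<Sum>j\<in>I. B i j * x i * x j)"
    for B :: "'i \<Rightarrow> 'i \<Rightarrow> real" and x c
    using insert.hyps by (intro sum.cong) auto
  have upd1: "(\<Sum>i\<in>I. b i * (x(k := c)) i) = (\<Sum>i\<in>I. b i * x i)" for b x and c :: real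
    using insert.hyps by (intro sum.cong) auto
  have Hq: "H k k * c\<^sup>2 + 2 * c * (\<Sum>j\<in>I. ?h j * x j) + (\<Sum>i\<in>I. \<Sum>j\<in>I. H i j * x i * x j) \<ge> 0" for c x
  proof -
    have "(\<Sum>j\<in>I. H k j * (x(k := c)) k * (x(k := c)) j) = c * (\<Sum>j\<in>I. ?h j * x j)"
      "(\<Sum>i\<in>I. H i k * (x(k := c)) i * (x(k := c)) k) = c * (\<Sum>j\<in>I. ?h j * x j)"
      unfolding sum_distrib_left using insert.hyps insert.prems(3) by (auto intro!: sum.cong)
    with insert.prems(2)[of "x(k := c)"] show ?thesis
      unfolding expand upd by (simp add: power2_eq_square)
  qed
  have A': "(\<Sum>i\<in>I. \<Sum>j\<in>I. A i j * x i * x j) \<ge> 0" for x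
  proof -
    have "(\<Sum>j\<in>I. A k j * (x(k := 0)) k * (x(k := 0)) j) = 0" "(\<Sum>i\<in>I. A i k * (x(k := 0)) i * (x(k := 0)) k) = 0"
      by auto
    with insert.prems(1)[of "x(k := 0)"] show ?thesis
      unfolding expand upd by simp
  qed
  have Hkk: "H k k \<ge> 0"
    using Hq[of 1 "\<lambda>_. 0"] by simp
  show ?case
  proof (cases "H k k = 0")
    case True
    \<comment> \<open>With \<open>H k k = 0\<close> the form is affine in \<open>c\<close>; a
      nonzero slope would make it unbounded below.\<close>
    have "?h j = 0" if j: "j \<in> I" for j
    proof (rule ccontr)
      assume nz: "?h j \<noteq> 0"
      define x where "x = (\<lambda>i. if i = j then 1 else 0 :: real)"
      have "(\<Sum>i\<in>I. ?h i * x i) = ?h j"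
        using j insert.hyps by (simp add: x_def if_distrib cong: if_cong)
      moreover define R where "R = (\<Sum>i\<in>I. \<Sum>j\<in>I. H i j * x i * x j)"
      ultimately have "2 * c * ?h j + R \<ge> 0" for c
        using Hq[of c x] True by simp
      from this[of "- (R + 1) / (2 * ?h j)"] show False
        using nz by (simp add: field_simps)
    qed
    then have "(\<Sum>i\<in>I. A k i * H k i) = 0" "(\<Sum>i\<in>I. A i k * H i k) = 0"
      using insert.prems(3)[of _ k] by auto
    moreover have "(\<Sum>i\<in>I. \<Sum>j\<in>I. A i j * H i j) \<ge> 0"
    proof (rule insert.IH[OF A' _ insert.prems(3)])
      show "(\<Sum>i\<in>I. \<Sum>j\<in>I. H i j * x i * x j) \<ge> 0" for x using Hq[of 0 x] by simp
    qed
    ultimately show ?thesis unfolding expand using True by simp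
  next
    case False
    then have pos: "H k k > 0" using Hkk by simp
    \<comment> \<open>The Schur complement of \<open>H k k\<close>: what remains of \<open>H\<close>
      after removing the rank-one part.\<close>
    define G where "G = (\<lambda>i j. H i j - ?h i * ?h j / H k k)"
    have sq: "(\<Sum>i\<in>I. \<Sum>j\<in>I. ?h i * ?h j / H k k * x i * x j) = (\<Sum>j\<in>I. ?h j * x j)\<^sup>2 / H k k" for x
      by (simp add: power2_eq_square sum_product sum_divide_distrib ac_simps)
    have "(\<Sum>i\<in>I. \<Sum>j\<in>I. A i j * G i j) \<ge> 0"
    proof (rule insert.IH[OF A'])
      show "(\<Sum>i\<in>I. \<Sum>j\<in>I. G i j * x i * x j) \<ge> 0" for x
      proof -
        define S where "S = (\<Sum>j\<in>I. ?h j * x j)"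
        have "(\<Sum>i\<in>I. \<Sum>j\<in>I. G i j * x i * x j) = (\<Sum>i\<in>I. \<Sum>j\<in>I. H i j * x i * x j) - S\<^sup>2 / H k k"
          unfolding G_def S_def sq[symmetric] by (simp add: left_diff_distrib sum_subtractf)
        \<comment> \<open>\<open>- S / H k k\<close> is the value of \<open>c\<close> that minimises
          the quadratic in \<open>Hq\<close>.\<close>
        moreover have "H k k * (- S / H k k)\<^sup>2 + 2 * (- S / H k k) * S = - S\<^sup>2 / H k k"
          using pos by (simp add: field_simps power2_eq_square)
        ultimately show ?thesis using Hq[of "- S / H k k" x] by (simp add: S_def)
      qed
      show "G i j = G j i" for i j
        using insert.prems(3)[of i j] by (simp add: G_def)
    qed
    moreover have "(\<Sum>i\<in>insert k I. \<Sum>j\<in>insert k I. A i j * ?h i * ?h j) / H k k \<ge> 0"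
      using insert.prems(1)[of ?h] pos by simp
    moreover have "(\<Sum>i\<in>insert k I. \<Sum>j\<in>insert k I. A i j * H i j) =
       (\<Sum>i\<in>I. \<Sum>j\<in>I. A i j * G i j) + (\<Sum>i\<in>insert k I. \<Sum>j\<in>insert k I. A i j * ?h i * ?h j) / H k k"
    proof -
      have "(\<Sum>i\<in>I. A i k * H i k) = (\<Sum>i\<in>I. A i k * H k i)"
        using insert.prems(3)[of _ k] by simp
      moreover have "(\<Sum>i\<in>I. \<Sum>j\<in>I. A i j * H i j) = (\<Sum>i\<in>I. \<Sum>j\<in>I. A i j * G i j) +
          (\<Sum>i\<in>I. \<Sum>j\<in>I. A i j * ?h i * ?h j) / H k k"
        by (simp add: G_def sum_divide_distrib sum.distrib[symmetric] algebra_simps)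
      ultimately show ?thesis
        unfolding expand add_divide_distrib sum_divide_distrib using pos
        by (simp add: add_divide_distrib sum_divide_distrib[symmetric] sum_distrib_right[symmetric])
    qed
    ultimately show ?thesis by simp
  qed
qed simp

section \<open>Functions of one real variable and convexity\<close>

lemma dir_deriv_real:
  fixes f :: "real \<Rightarrow> real"
  assumes "f differentiable_on UNIV"
  shows "dir_deriv UNIV v f x = v * deriv f x"
proof -
  have "(f has_real_derivative dir_deriv UNIV 1 f x) (at x)"
    using has_real_derivative_along_line[OF assms, of 0 x 1] by simp
  then have "deriv f x = dir_deriv UNIV 1 f x" by (rule DERIV_imp_deriv)
  then show ?thesis using dir_deriv_scaleR[OF assms, of x v 1] by simp
qed

lemma has_jet2_compose_real:
  fixes F u :: "real \<Rightarrow> real"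
  assumes F: "Ck_on 2 UNIV F" and u: "has_jet2 u u1 u2"
  shows "has_jet2 (\<lambda>s. F (u s)) (deriv F (u 0) * u1) (deriv (deriv F) (u 0) * u1\<^sup>2 + deriv F (u 0) * u2)"
proof -
  have d: "F differentiable_on UNIV" "\<And>u. dir_deriv UNIV u F differentiable_on UNIV"
    using F by (auto simp: eval_nat_numeral)
  have eq: "dir_deriv UNIV 1 F = deriv F"
    using dir_deriv_real[OF d(1), of 1] by auto
  have "dir_deriv UNIV u1 (dir_deriv UNIV u1 F) (u 0) = u1 * dir_deriv UNIV u1 (dir_deriv UNIV 1 F) (u 0)"
    using dir_deriv_dir_deriv_sum[OF F, of "u 0" u1 "\<lambda>_. u1" "\<lambda>_. 1" "{()}"] by simp
  also have "\<dots> = u1 * (u1 * deriv (deriv F) (u 0))"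
    using dir_deriv_real[OF d(2)[of 1]] eq by simp
  finally show ?thesis
    using has_jet2_compose[OF F u] dir_deriv_real[OF d(1)]
    by (simp add: power2_eq_square ac_simps)
qed

text \<open>Subtracting the tangent line at \<open>x\<close> leaves a function with a minimum at
  \<open>x\<close> and the same second derivative.\<close>

lemma convex_on_imp_deriv2_nonneg:
  fixes f :: "real \<Rightarrow> real"
  assumes f: "Ck_on 2 UNIV f" and "convex_on UNIV f"
  shows "deriv (deriv f) x \<ge> 0"
proof -
  have "f differentiable_on UNIV" using f by (auto simp: eval_nat_numeral)
  then have der: "(f has_real_derivative deriv f x) (at x)"
    using has_real_derivative_along_line[of f UNIV 0 x 1] dir_deriv_real[of f 1 x] by simp
  have jx: "has_jet2 (\<lambda>s. x + s) 1 0"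
    using has_jet2_add[OF has_jet2_const has_jet2_ident] by simp
  have "has_jet2 (\<lambda>s. f (x + s) + - deriv f x * s) (deriv f x + - deriv f x) (deriv (deriv f) x)"
    using has_jet2_add[OF has_jet2_compose_real[OF f jx] has_jet2_cmult[OF has_jet2_ident, of "- deriv f x"]]
    by simp
  moreover have "\<forall>\<^sub>F s in nhds 0. f (x + 0) + - deriv f x * 0 \<le> f (x + s) + - deriv f x * s"
  proof (rule always_eventually, rule allI)
    fix s
    have "f (x + s) - f x \<ge> deriv f x * (x + s - x)"
      using assms(2) der by (intro convex_on_imp_above_tangent[where A = UNIV]) auto
    then show "f (x + 0) + - deriv f x * 0 \<le> f (x + s) + - deriv f x * s" by simp
  qed
  ultimately show ?thesis by (rule has_jet2_local_min(2))
qed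

section \<open>Exchange of derivatives and the Hessian as a quadratic form\<close>

text \<open>Two exchanges move the innermost direction outside. With \<open>k = (0, 1)\<close> the
  time derivative passes two space derivatives.\<close>

lemma dir_deriv_commute3:
  assumes "smooth_on S f" "open S" "x \<in> S"
  shows "dir_deriv S u (dir_deriv S v (dir_deriv S k f)) x = dir_deriv S k (dir_deriv S u (dir_deriv S v f)) x"
proof -
  have "dir_deriv S u (dir_deriv S v (dir_deriv S k f)) x = dir_deriv S u (dir_deriv S k (dir_deriv S v f)) x"
    by (intro dir_deriv_cong dir_deriv_commute smooth_on_imp_Ck_on assms)
  also have "\<dots> = dir_deriv S k (dir_deriv S u (dir_deriv S v f)) x"
    by (intro dir_deriv_commute smooth_on_imp_Ck_on smooth_on_dir_deriv assms)
  finally show ?thesis .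
qed

lemma dir_deriv2_linear_combination:
  assumes "Ck_on 2 S f" "open S" "x \<in> S"
  shows "dir_deriv S (u + r *\<^sub>R v) (dir_deriv S (u + r *\<^sub>R v) f) x = dir_deriv S u (dir_deriv S u f) x
    + 2 * r * dir_deriv S v (dir_deriv S u f) x + r\<^sup>2 * dir_deriv S v (dir_deriv S v f) x"
proof -
  have d: "\<And>u. dir_deriv S u f differentiable_on S"
    using assms(1) by (auto simp: eval_nat_numeral)
  have lin: "dir_deriv S k (dir_deriv S (u + r *\<^sub>R v) f) x
      = dir_deriv S k (dir_deriv S u f) x + r * dir_deriv S k (dir_deriv S v f) x" for k
    using dir_deriv_dir_deriv_sum[OF assms, of k "\<lambda>b. if b then 1 else r" "\<lambda>b. if b then u else v" UNIV]
    by (simp add: UNIV_bool add.commute)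
  have "dir_deriv S (u + r *\<^sub>R v) (dir_deriv S (u + r *\<^sub>R v) f) x =
     (dir_deriv S u (dir_deriv S u f) x + r * dir_deriv S u (dir_deriv S v f) x) +
     r * (dir_deriv S v (dir_deriv S u f) x + r * dir_deriv S v (dir_deriv S v f) x)"
    unfolding lin using dir_deriv_add[OF d assms(3)] dir_deriv_scaleR[OF d assms(3)] by (simp add: algebra_simps)
  then show ?thesis
    using dir_deriv_commute[OF assms, of u v] by (simp add: power2_eq_square algebra_simps)
qed

text \<open>With the coordinate axes this is the Hessian in coordinates, with a one-element index
  set its homogeneity of degree two.\<close>

lemma dir_deriv2_eq_sum:
  assumes "Ck_on 2 S f" "open S" "x \<in> S" and v: "v = (\<Sum>i\<in>I. c i *\<^sub>R e i)"
  shows "dir_deriv S v (dir_deriv S v f) x = (\<Sum>i\<in>I. \<Sum>j\<in>I. dir_deriv S (e j) (dir_deriv S (e i) f) x * c i * c j)"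
proof -
  have d: "\<And>u. dir_deriv S u f differentiable_on S"
    using assms(1) by (auto simp: eval_nat_numeral)
  show ?thesis
    unfolding v dir_deriv_dir_deriv_sum[OF assms(1-3)] dir_deriv_sum[OF d assms(3)]
    by (simp add: sum_distrib_left ac_simps)
qed

lemma sum_axis_scaleR: "(\<Sum>i\<in>UNIV. (\<xi> $ i) *\<^sub>R axis i 1) = (\<xi> :: real ^ 'n)"
  using basis_expansion[of \<xi>] by (simp add: scalar_mult_eq_scaleR)

section \<open>Joint continuity in point and direction\<close>

text \<open>Smoothness gives continuity for each fixed direction; the basis expansion extends it to
  directions that vary continuously.\<close>

lemma continuous_on_dir_deriv:
  fixes f :: "'a::euclidean_space \<Rightarrow> real"
  assumes f: "smooth_on S f" and "continuous_on T v" and q: "continuous_on T q" "q ` T \<subseteq> S"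
  shows "continuous_on T (\<lambda>x. dir_deriv S (v x) f (q x))"
proof -
  have "continuous_on T (\<lambda>x. \<Sum>b\<in>Basis. (v x \<bullet> b) * dir_deriv S b f (q x))"
    by (intro continuous_intros assms
        continuous_on_compose2[OF smooth_on_imp_continuous_on[OF smooth_on_dir_deriv[OF f]] q])
  then show ?thesis
    using dir_deriv_eq_sum_Basis[OF smooth_on_imp_differentiable_on[OF f]] q(2)
    by (subst continuous_on_cong) auto
qed

lemma continuous_on_dir_deriv2:
  fixes f :: "'a::euclidean_space \<Rightarrow> real"
  assumes f: "smooth_on S f" "open S" and v: "continuous_on T v" and q: "continuous_on T q" "q ` T \<subseteq> S"
  shows "continuous_on T (\<lambda>x. dir_deriv S (v x) (dir_deriv S (v x) f) (q x))"
proof -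
  have "continuous_on T (\<lambda>x. \<Sum>b\<in>Basis. (v x \<bullet> b) * dir_deriv S (v x) (dir_deriv S b f) (q x))"
    by (intro continuous_intros continuous_on_dir_deriv smooth_on_dir_deriv assms)
  moreover have "dir_deriv S (v x) (dir_deriv S (v x) f) (q x) =
      (\<Sum>b\<in>Basis. (v x \<bullet> b) * dir_deriv S (v x) (dir_deriv S b f) (q x))" if "x \<in> T" for x
    using dir_deriv_dir_deriv_sum[OF smooth_on_imp_Ck_on[OF f(1)] f(2), of "q x" "v x" "\<lambda>b. v x \<bullet> b" "\<lambda>b. b" Basis]
      q(2) that by (auto simp: euclidean_representation)
  ultimately show ?thesis by (subst continuous_on_cong) auto
qed

section \<open>The flow on an open set of space-time\<close>

abbreviation sderiv :: "((real ^ 'n) \<times> real) set \<Rightarrow> real ^ 'n \<Rightarrow> ((real ^ 'n) \<times> real \<Rightarrow> real) \<Rightarrow> (real ^ 'n) \<times> real \<Rightarrow> real" where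
  "sderiv U v \<equiv> dir_deriv U (v, 0)"

definition sgrad :: "((real ^ 'n) \<times> real) set \<Rightarrow> ((real ^ 'n) \<times> real \<Rightarrow> real) \<Rightarrow> (real ^ 'n) \<times> real \<Rightarrow> real ^ 'n" where
  "sgrad U f z = (\<chi> k. sderiv U (axis k 1) f z)"

text \<open>On an open set of space-time, space and time derivatives are directional derivatives of
  one smooth function. The squared gradient norm is written with \<open>powr 2\<close> so that the
  \<open>b1\<close> and \<open>b2\<close> terms can be treated by one lemma.\<close>

locale quasilinear_flow =
  fixes U :: "((real ^ 'n) \<times> real) set" and W :: "(real ^ 'n) \<times> real \<Rightarrow> real"
    and a :: "'n \<Rightarrow> 'n \<Rightarrow> real ^ 'n \<Rightarrow> real" and b1 b2 b3 \<rho> :: "real \<Rightarrow> real" and p :: real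
  assumes U: "open U" and W: "smooth_on U W"
    and a_smooth: "\<And>i j. smooth_on UNIV (a i j)"
    and a_nonneg: "\<And>q \<xi>. (\<Sum>i\<in>UNIV. \<Sum>j\<in>UNIV. a i j q * \<xi> i * \<xi> j) \<ge> 0"
    and b_smooth: "smooth_on UNIV b1" "smooth_on UNIV b2" "smooth_on UNIV b3"
    and b_convex: "convex_on UNIV b1" "convex_on UNIV b2" "convex_on UNIV b3"
    and rho_smooth: "smooth_on UNIV \<rho>"
    and rho_pos: "\<And>z. z \<in> U \<Longrightarrow> \<rho> (W z) > 0"
    and rho_ode: "\<And>z. z \<in> U \<Longrightarrow> deriv (deriv \<rho>) (W z) = (deriv \<rho> (W z))\<^sup>2 / (2 * \<rho> (W z))"
    and p: "p \<ge> 2"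
    and pde: "\<And>z. z \<in> U \<Longrightarrow> dir_deriv U (0, 1) W z =
        \<rho> (W z) * (\<Sum>i\<in>UNIV. \<Sum>j\<in>UNIV. a i j (sgrad U W z) * sderiv U (axis j 1) (sderiv U (axis i 1) W) z)
        + b1 (W z) * norm (sgrad U W z) powr p + b2 (W z) * norm (sgrad U W z) powr 2 + b3 (W z)"
begin

abbreviation "D \<equiv> sderiv U"

lemma smooth_D [simp, intro]: "smooth_on U f \<Longrightarrow> smooth_on U (D v f)"
  by (rule smooth_on_dir_deriv)

lemma has_jet2_sline:
  assumes "smooth_on U f" "z \<in> U"
  shows "has_jet2 (\<lambda>s. f (z + s *\<^sub>R (v, 0))) (D v f z) (D v (D v f) z)"
  by (rule has_jet2_along_line[OF smooth_on_imp_Ck_on[OF assms(1)] U assms(2)])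

text \<open>The direction is varied together with the point: \<open>v = \<alpha> + s c \<xi>\<close> at \<open>z + s \<xi>\<close>. The terms in \<open>c\<close>
  absorb the third derivatives of \<open>W\<close> in the evolution equation.\<close>

lemma second_derivative_minimum:
  assumes z: "z \<in> U" and \<alpha>: "norm \<alpha> = 1" and lam: "lam = D \<alpha> (D \<alpha> W) z"
    and min: "\<forall>\<^sub>F y in nhds (fst z). \<forall>v. lam * (norm v)\<^sup>2 \<le> D v (D v W) (y, snd z)"
  shows "D \<xi> (D \<alpha> W) z = lam * (\<alpha> \<bullet> \<xi>)"
    and "D \<xi> (D \<alpha> (D \<alpha> W)) z = 0"
    and "D \<xi> (D \<xi> (D \<alpha> (D \<alpha> W))) z + 4 * c * D \<xi> (D \<xi> (D \<alpha> W)) z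
      + 2 * c\<^sup>2 * D \<xi> (D \<xi> W) z - 2 * lam * c\<^sup>2 * (norm \<xi>)\<^sup>2 \<ge> 0"
proof -
  define P Q R where "P s = D \<alpha> (D \<alpha> W) (z + s *\<^sub>R (\<xi>, 0))"
    and "Q s = D \<xi> (D \<alpha> W) (z + s *\<^sub>R (\<xi>, 0))" and "R s = D \<xi> (D \<xi> W) (z + s *\<^sub>R (\<xi>, 0))" for s :: real
  have jet: "has_jet2 P (D \<xi> (D \<alpha> (D \<alpha> W)) z) (D \<xi> (D \<xi> (D \<alpha> (D \<alpha> W))) z)"
     "has_jet2 Q (D \<xi> (D \<xi> (D \<alpha> W)) z) (D \<xi> (D \<xi> (D \<xi> (D \<alpha> W))) z)"
     "has_jet2 R (D \<xi> (D \<xi> (D \<xi> W)) z) (D \<xi> (D \<xi> (D \<xi> (D \<xi> W))) z)"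
    unfolding P_def Q_def R_def by (intro has_jet2_sline smooth_D W z)+
  have at0: "P 0 = lam" "Q 0 = D \<xi> (D \<alpha> W) z" "R 0 = D \<xi> (D \<xi> W) z"
    by (simp_all add: P_def Q_def R_def lam zero_prod_def[symmetric])
  \<comment> \<open>The Hessian form minus \<open>lam\<close> times the squared norm, for the
    direction \<open>\<alpha> + (s * c) *\<^sub>R \<xi>\<close> along the line, sorted by powers of
    \<open>c\<close>. It is 0 at \<open>s = 0\<close> and nonnegative nearby.\<close>
  define f where "f c s = P s + 2 * c * (s * Q s) + c\<^sup>2 * (s * (s * R s))
     + (- lam * (norm \<alpha>)\<^sup>2 + - 2 * lam * c * (\<alpha> \<bullet> \<xi>) * s + - lam * c\<^sup>2 * (norm \<xi>)\<^sup>2 * (s * s))" for c s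
  have jet_f: "has_jet2 (f c) (D \<xi> (D \<alpha> (D \<alpha> W)) z + 2 * c * D \<xi> (D \<alpha> W) z - 2 * lam * c * (\<alpha> \<bullet> \<xi>))
     (D \<xi> (D \<xi> (D \<alpha> (D \<alpha> W))) z + 4 * c * D \<xi> (D \<xi> (D \<alpha> W)) z
      + 2 * c\<^sup>2 * D \<xi> (D \<xi> W) z - 2 * lam * c\<^sup>2 * (norm \<xi>)\<^sup>2)" for c
    using has_jet2_add[OF has_jet2_add[OF has_jet2_add[OF jet(1)
        has_jet2_cmult[OF has_jet2_mult[OF has_jet2_ident jet(2)], of "2 * c"]]
        has_jet2_cmult[OF has_jet2_mult[OF has_jet2_ident has_jet2_mult[OF has_jet2_ident jet(3)]], of "c\<^sup>2"]]
        has_jet2_add[OF has_jet2_add[OF has_jet2_const[of "- lam * (norm \<alpha>)\<^sup>2"]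
            has_jet2_cmult[OF has_jet2_ident, of "- 2 * lam * c * (\<alpha> \<bullet> \<xi>)"]]
          has_jet2_cmult[OF has_jet2_mult[OF has_jet2_ident has_jet2_ident], of "- lam * c\<^sup>2 * (norm \<xi>)\<^sup>2"]]]
    unfolding f_def[abs_def] by (simp add: at0 algebra_simps)
  have line: "((\<lambda>s. fst z + s *\<^sub>R \<xi>) \<longlongrightarrow> fst z + 0 *\<^sub>R \<xi>) (nhds 0)"
    by (intro tendsto_intros filterlim_ident)
  have inU: "\<forall>\<^sub>F s in nhds 0. z + s *\<^sub>R (\<xi>, 0) \<in> U"
    by (rule eventually_line_in_open[OF U z])
  have min': "\<forall>\<^sub>F s in nhds 0. \<forall>v. lam * (norm v)\<^sup>2 \<le> D v (D v W) (fst z + s *\<^sub>R \<xi>, snd z)"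
    using eventually_compose_filterlim[OF min, of "\<lambda>s. fst z + s *\<^sub>R \<xi>" "nhds 0"] line by simp
  have f_ge: "\<forall>\<^sub>F s in nhds 0. f c 0 \<le> f c s" for c
    using inU min'
  proof eventually_elim
    case (elim s)
    have zs: "(fst z + s *\<^sub>R \<xi>, snd z) = z + s *\<^sub>R (\<xi>, 0)" by (cases z) simp
    have v: "(\<alpha> + (s * c) *\<^sub>R \<xi>, 0) = (\<alpha>, 0) + (s * c) *\<^sub>R (\<xi>, 0 :: real)" by simp
    have nv: "(norm (\<alpha> + (s * c) *\<^sub>R \<xi>))\<^sup>2 = (norm \<alpha>)\<^sup>2 + 2 * s * c * (\<alpha> \<bullet> \<xi>) + (s * c)\<^sup>2 * (norm \<xi>)\<^sup>2"
      unfolding power2_norm_eq_inner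
      by (simp add: inner_add_left inner_add_right inner_commute power2_eq_square)
    have "f c s = D (\<alpha> + (s * c) *\<^sub>R \<xi>) (D (\<alpha> + (s * c) *\<^sub>R \<xi>) W) (z + s *\<^sub>R (\<xi>, 0)) - lam * (norm (\<alpha> + (s * c) *\<^sub>R \<xi>))\<^sup>2"
      unfolding v dir_deriv2_linear_combination[OF smooth_on_imp_Ck_on[OF W] U elim(1)]
      using nv by (simp add: f_def P_def Q_def R_def power_mult_distrib algebra_simps)
        (simp add: power2_eq_square)
    also have "\<dots> \<ge> 0" using elim(2) unfolding zs by auto
    finally show ?case by (simp add: f_def at0 \<alpha>)
  qed
  \<comment> \<open>The slope vanishes for every \<open>c\<close>: \<open>c = 0\<close> isolates the
    gradient of \<open>D \<alpha> (D \<alpha> W)\<close>, then \<open>c = 1\<close> the eigenvector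
    equation.\<close>
  have first: "D \<xi> (D \<alpha> (D \<alpha> W)) z + 2 * c * D \<xi> (D \<alpha> W) z - 2 * lam * c * (\<alpha> \<bullet> \<xi>) = 0" for c
    by (rule has_jet2_local_min(1)[OF jet_f f_ge])
  show "D \<xi> (D \<alpha> (D \<alpha> W)) z = 0" using first[of 0] by simp
  then show "D \<xi> (D \<alpha> W) z = lam * (\<alpha> \<bullet> \<xi>)" using first[of 1] by simp
  show "D \<xi> (D \<xi> (D \<alpha> (D \<alpha> W))) z + 4 * c * D \<xi> (D \<xi> (D \<alpha> W)) z
      + 2 * c\<^sup>2 * D \<xi> (D \<xi> W) z - 2 * lam * c\<^sup>2 * (norm \<xi>)\<^sup>2 \<ge> 0"
    by (rule has_jet2_local_min(2)[OF jet_f f_ge])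
qed

text \<open>Let \<open>u\<close> have second derivative \<lambda>, and let \<open>q\<close> have
  velocity \<lambda> times \<alpha> and second derivative 0. Up to the factor \<lambda>, this
  majorises the second derivative of \<open>b (u s) * norm (q s) powr r\<close> without its
  \<open>deriv (deriv b)\<close> term, whose sign convexity gives.\<close>

definition lower_order :: "(real \<Rightarrow> real) \<Rightarrow> real \<Rightarrow> (real ^ 'n) \<times> real \<Rightarrow> real ^ 'n \<Rightarrow> real" where
  "lower_order b r z \<alpha> = (\<bar>deriv b (W z)\<bar> * (1 + 2 * r * \<bar>D \<alpha> W z\<bar>) + \<bar>b (W z)\<bar> * r\<^sup>2 * \<bar>D \<alpha> (D \<alpha> W) z\<bar>)
     * (1 + norm (sgrad U W z)) powr r"

text \<open>The coefficient of \<open>\<lambda> = w\<^sub>\<alpha>\<^sub>\<alpha>\<close> that remains when the equation is differentiated twice along \<open>\<alpha>\<close>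
  at the minimum; for the terms with \<open>b1\<close>, \<open>b2\<close>, \<open>b3\<close> only a majorant of it.\<close>

definition evolution_factor :: "(real ^ 'n) \<times> real \<Rightarrow> real ^ 'n \<Rightarrow> real" where
  "evolution_factor z \<alpha> =
     deriv \<rho> (W z) * (\<Sum>i\<in>UNIV. \<Sum>j\<in>UNIV. a i j (sgrad U W z) * D (axis j 1) (D (axis i 1) W) z)
   + 2 * deriv \<rho> (W z) * D \<alpha> W z * (\<Sum>i\<in>UNIV. \<Sum>j\<in>UNIV. dir_deriv UNIV \<alpha> (a i j) (sgrad U W z) * D (axis j 1) (D (axis i 1) W) z)
   + \<rho> (W z) * (D \<alpha> (D \<alpha> W) z
        * (\<Sum>i\<in>UNIV. \<Sum>j\<in>UNIV. dir_deriv UNIV \<alpha> (dir_deriv UNIV \<alpha> (a i j)) (sgrad U W z) * D (axis j 1) (D (axis i 1) W) z)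
      + 2 * (\<Sum>i\<in>UNIV. \<Sum>j\<in>UNIV. dir_deriv UNIV \<alpha> (a i j) (sgrad U W z) * D \<alpha> (D (axis j 1) (D (axis i 1) W)) z))
   + deriv (deriv \<rho>) (W z) * (D \<alpha> W z)\<^sup>2 * (\<Sum>i\<in>UNIV. a i i (sgrad U W z))
   + lower_order b1 p z \<alpha> + lower_order b2 2 z \<alpha> + \<bar>deriv b3 (W z)\<bar>"

text \<open>Apart from the nonnegative term with \<open>deriv (deriv b)\<close>, every term carries
  a factor \<open>lam\<close>; in \<open>N1\<close> and \<open>N2\<close> it comes from the velocity
  of \<open>q\<close>. As \<open>lam \<le> 0\<close>, a majorant of the cofactor yields a lower
  bound.\<close>

lemma lower_order_jet:
  assumes b: "smooth_on UNIV b" "convex_on UNIV b" and r: "r \<ge> 2" and u: "has_jet2 u u1 lam" "u 0 = W z" "u1 = D \<alpha> W z"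
    and q: "has_jet2 q (lam *\<^sub>R \<alpha>) 0" "q 0 = sgrad U W z" and \<alpha>: "norm \<alpha> = 1"
    and lam: "lam \<le> 0" "lam = D \<alpha> (D \<alpha> W) z"
  shows "\<exists>B1 B2. has_jet2 (\<lambda>s. b (u s) * norm (q s) powr r) B1 B2 \<and> lam * lower_order b r z \<alpha> \<le> B2"
proof -
  obtain N1 N2 where N: "has_jet2 (\<lambda>s. norm (q s) powr r) N1 N2"
    "\<bar>N1\<bar> \<le> r * (1 + norm (q 0)) powr r * norm (lam *\<^sub>R \<alpha>)"
    "\<bar>N2\<bar> \<le> r\<^sup>2 * (1 + norm (q 0)) powr r * (norm (lam *\<^sub>R \<alpha>))\<^sup>2"
    using has_jet2_norm_powr[OF r q(1)] by blast
  define M where "M = (1 + norm (q 0)) powr r"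
  define B0 B' B'' where "B0 = b (u 0)" and "B' = deriv b (u 0)" and "B'' = deriv (deriv b) (u 0)"
  have N1: "\<bar>N1\<bar> \<le> r * M * \<bar>lam\<bar>" and N2: "\<bar>N2\<bar> \<le> r\<^sup>2 * M * lam\<^sup>2"
    using N(2,3) \<alpha> by (simp_all add: M_def)
  have N0: "0 \<le> norm (q 0) powr r" "norm (q 0) powr r \<le> M"
    using r by (auto simp: M_def intro!: powr_mono2)
  have "B'' \<ge> 0"
    unfolding B''_def by (rule convex_on_imp_deriv2_nonneg[OF smooth_on_imp_Ck_on[OF b(1)] b(2)])
  then have t1: "B'' * u1\<^sup>2 * norm (q 0) powr r \<ge> 0" using N0 by simp
  have t2: "B' * lam * norm (q 0) powr r \<ge> lam * (\<bar>B'\<bar> * M)"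
  proof -
    have "B' * norm (q 0) powr r \<le> \<bar>B'\<bar> * M"
      using N0 by (intro mult_mono) auto
    from mult_left_mono_neg[OF this lam(1)] show ?thesis by (simp add: ac_simps)
  qed
  have t3: "2 * (B' * u1) * N1 \<ge> lam * (\<bar>B'\<bar> * (2 * r * \<bar>u1\<bar>) * M)"
  proof -
    have "\<bar>2 * (B' * u1) * N1\<bar> = 2 * (\<bar>B'\<bar> * \<bar>u1\<bar>) * \<bar>N1\<bar>" by (simp add: abs_mult)
    also have "\<dots> \<le> 2 * (\<bar>B'\<bar> * \<bar>u1\<bar>) * (r * M * \<bar>lam\<bar>)"
      by (intro mult_left_mono N1) auto
    also have "\<dots> = - (lam * (\<bar>B'\<bar> * (2 * r * \<bar>u1\<bar>) * M))"
      using lam(1) by simp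
    finally show ?thesis by linarith
  qed
  have t4: "B0 * N2 \<ge> lam * (\<bar>B0\<bar> * r\<^sup>2 * \<bar>lam\<bar> * M)"
  proof -
    have "\<bar>B0 * N2\<bar> = \<bar>B0\<bar> * \<bar>N2\<bar>" by (simp add: abs_mult)
    also have "\<dots> \<le> \<bar>B0\<bar> * (r\<^sup>2 * M * lam\<^sup>2)"
      by (intro mult_left_mono N2) auto
    also have "\<dots> = - (lam * (\<bar>B0\<bar> * r\<^sup>2 * \<bar>lam\<bar> * M))"
      using lam(1) by (simp add: power2_eq_square)
    finally show ?thesis by linarith
  qed
  have eq: "lower_order b r z \<alpha> = \<bar>B'\<bar> * M + \<bar>B'\<bar> * (2 * r * \<bar>u1\<bar>) * M + \<bar>B0\<bar> * r\<^sup>2 * \<bar>lam\<bar> * M"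
    unfolding lower_order_def M_def B0_def B'_def u(2,3) q(2) lam(2)[symmetric] by (simp add: algebra_simps)
  have "lam * lower_order b r z \<alpha> \<le> B0 * N2 + 2 * (B' * u1) * N1 + (B'' * u1\<^sup>2 + B' * lam) * norm (q 0) powr r"
    using t1 t2 t3 t4 unfolding eq by (simp add: distrib_left distrib_right)
  then show ?thesis
    using has_jet2_mult[OF has_jet2_compose_real[OF smooth_on_imp_Ck_on[OF b(1)] u(1)] N(1)]
    unfolding B0_def B'_def B''_def by blast
qed

text \<open>The second derivative of the time derivative of \<open>W\<close> along the line in
  direction \<alpha> is computed twice: by exchanging derivatives, and from the right-hand side of
  the equation.\<close>

lemma evolution_at_minimum:
  assumes z: "z \<in> U" and \<alpha>: "norm \<alpha> = 1" and lam: "lam = D \<alpha> (D \<alpha> W) z" "lam \<le> 0"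
    and min: "\<forall>\<^sub>F y in nhds (fst z). \<forall>v. lam * (norm v)\<^sup>2 \<le> D v (D v W) (y, snd z)"
  shows "lam * evolution_factor z \<alpha> \<le> dir_deriv U (0, 1) (D \<alpha> (D \<alpha> W)) z"
proof -
  note crit = second_derivative_minimum[OF z \<alpha> lam(1) min]
  define e where "e i = (axis i 1 :: real ^ 'n)" for i
  define l where "l s = z + s *\<^sub>R (\<alpha>, 0 :: real)" for s
  have l0: "l 0 = z" by (simp add: l_def zero_prod_def[symmetric])
  define u q where "u s = W (l s)" and "q s = sgrad U W (l s)" for s
  have u0: "u 0 = W z" and q0: "q 0 = sgrad U W z" by (simp_all add: u_def q_def l0)
  define u1 where "u1 = D \<alpha> W z"
  have ju: "has_jet2 u u1 lam"
    unfolding u_def l_def lam(1) u1_def by (rule has_jet2_sline[OF W z])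
  have com: "D v (D \<xi> f) y = D \<xi> (D v f) y" if "smooth_on U f" "y \<in> U" for v \<xi> f y
    by (rule dir_deriv_commute[OF smooth_on_imp_Ck_on[OF that(1)] U that(2)])
  have com3: "D v (D \<xi> (D k f)) y = D k (D v (D \<xi> f)) y" if "smooth_on U f" "y \<in> U" for v \<xi> k f y
    by (rule dir_deriv_commute3[OF that(1) U that(2)])
  \<comment> \<open>The Hessian maps \<alpha> to \<open>lam *\<^sub>R \<alpha>\<close>, and the
    second derivative of the gradient along \<alpha> is the gradient of
    \<open>D \<alpha> (D \<alpha> W)\<close>, which is 0 at \<open>z\<close>.\<close>
  have jq: "has_jet2 q (lam *\<^sub>R \<alpha>) 0"
  proof -
    have "D \<alpha> (D (e k) W) z = (lam *\<^sub>R \<alpha>) $ k" for k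
      using com[OF W z, of \<alpha> "e k"] crit(1)[of "e k"]
      by (simp add: e_def inner_axis)
    moreover have "D \<alpha> (D \<alpha> (D (e k) W)) z = 0" for k
      using com3[OF W z, of \<alpha> \<alpha> "e k"] crit(2) by simp
    ultimately have "has_jet2 (\<lambda>s. D (e k) W (l s)) ((lam *\<^sub>R \<alpha>) $ k) ((0 :: real ^ 'n) $ k)" for k
      using has_jet2_sline[OF smooth_D[OF W] z, of "e k" \<alpha>] by (simp add: l_def)
    then have "has_jet2 (\<lambda>s. \<chi> k. D (e k) W (l s)) (\<chi> k. (lam *\<^sub>R \<alpha>) $ k) (\<chi> k. (0 :: real ^ 'n) $ k)"
      by (rule has_jet2_vec)
    then show ?thesis
      unfolding q_def sgrad_def e_def vec_lambda_eta .
  qed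
  define w w1 where "w i j = D (e j) (D (e i) W) z" and "w1 i j = D \<alpha> (D (e j) (D (e i) W)) z" for i j
  define w2 where "w2 i j = D \<alpha> (D \<alpha> (D (e j) (D (e i) W))) z" for i j
  define A A1 A2 where "A i j = a i j (q 0)" and "A1 i j = dir_deriv UNIV \<alpha> (a i j) (q 0)"
    and "A2 i j = dir_deriv UNIV \<alpha> (dir_deriv UNIV \<alpha> (a i j)) (q 0)" for i j
  have jw: "has_jet2 (\<lambda>s. D (e j) (D (e i) W) (l s)) (w1 i j) (w2 i j)" for i j
    unfolding l_def w1_def w2_def by (intro has_jet2_sline smooth_D W z)
  have ja: "has_jet2 (\<lambda>s. a i j (q s)) (lam * A1 i j) (lam\<^sup>2 * A2 i j)" for i j
  proof -
    have C2: "Ck_on 2 UNIV (a i j)" and d: "a i j differentiable_on UNIV"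
      using a_smooth smooth_on_imp_Ck_on smooth_on_imp_differentiable_on by blast+
    have "dir_deriv UNIV (lam *\<^sub>R \<alpha>) (dir_deriv UNIV (lam *\<^sub>R \<alpha>) (a i j)) (q 0) = lam\<^sup>2 * A2 i j"
      using dir_deriv2_eq_sum[OF C2 open_UNIV UNIV_I, where I = "{()}" and c = "\<lambda>_. lam" and e = "\<lambda>_. \<alpha>" and v = "lam *\<^sub>R \<alpha>"]
      by (simp add: A2_def power2_eq_square)
    then show ?thesis
      using has_jet2_compose[OF C2 jq] dir_deriv_scaleR[OF d, of "q 0" lam \<alpha>] dir_deriv_zero[OF d, of "q 0"]
      by (simp add: A1_def)
  qed
  \<comment> \<open>Contractions of the coefficients with the Hessian and its derivatives along
    \<alpha>. The \<open>X\<close> terms contain derivatives of \<open>a\<close> and so always come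
    with a factor \<open>lam\<close>.\<close>
  define T0 T1 T2 X1 X2 X3 tr where "T0 = (\<Sum>i\<in>UNIV. \<Sum>j\<in>UNIV. A i j * w i j)"
    and "T1 = (\<Sum>i\<in>UNIV. \<Sum>j\<in>UNIV. A i j * w1 i j)" and "T2 = (\<Sum>i\<in>UNIV. \<Sum>j\<in>UNIV. A i j * w2 i j)"
    and "X1 = (\<Sum>i\<in>UNIV. \<Sum>j\<in>UNIV. A1 i j * w i j)" and "X2 = (\<Sum>i\<in>UNIV. \<Sum>j\<in>UNIV. A2 i j * w i j)"
    and "X3 = (\<Sum>i\<in>UNIV. \<Sum>j\<in>UNIV. A1 i j * w1 i j)" and "tr = (\<Sum>i\<in>UNIV. A i i)"
  define S where "S s = (\<Sum>i\<in>UNIV. \<Sum>j\<in>UNIV. a i j (q s) * D (e j) (D (e i) W) (l s))" for s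
  have S0: "S 0 = T0" by (simp add: S_def T0_def A_def w_def l0)
  have jS: "has_jet2 S (T1 + lam * X1) (T2 + 2 * lam * X3 + lam\<^sup>2 * X2)"
  proof -
    have "has_jet2 S (\<Sum>i\<in>UNIV. \<Sum>j\<in>UNIV. A i j * w1 i j + lam * A1 i j * w i j)
        (\<Sum>i\<in>UNIV. \<Sum>j\<in>UNIV. A i j * w2 i j + 2 * (lam * A1 i j) * w1 i j + lam\<^sup>2 * A2 i j * w i j)"
      using has_jet2_mult[OF ja jw] unfolding S_def A_def w_def l0[symmetric]
      by (intro has_jet2_sum) auto
    then show ?thesis
      by (simp add: T1_def T2_def X1_def X2_def X3_def sum.distrib sum_distrib_left ac_simps)
  qed
  \<comment> \<open>The inequality for all \<xi> says that the matrix \<open>H\<close> below is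
    positive semidefinite; it is contracted with \<open>A\<close>.\<close>
  have trace: "T2 + 4 * c * T1 + 2 * c\<^sup>2 * T0 - 2 * lam * c\<^sup>2 * tr \<ge> 0" for c
  proof -
    define H where "H i j = w2 i j + 4 * c * w1 i j + 2 * c\<^sup>2 * w i j - (if i = j then 2 * lam * c\<^sup>2 else 0)" for i j
    have w1: "w1 i j = D (e j) (D (e i) (D \<alpha> W)) z" for i j
      using com3[OF W z, of "e j" "e i" \<alpha>] by (simp add: w1_def)
    have w2: "w2 i j = D (e j) (D (e i) (D \<alpha> (D \<alpha> W))) z" for i j
    proof -
      have "w2 i j = D (e j) (D \<alpha> (D \<alpha> (D (e i) W))) z"
        unfolding w2_def by (rule com3[OF smooth_D[OF W] z])
      also have "\<dots> = D (e j) (D (e i) (D \<alpha> (D \<alpha> W))) z"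
        by (intro dir_deriv_cong com3 W z)
      finally show ?thesis .
    qed
    have quad: "D \<xi> (D \<xi> f) z = (\<Sum>i\<in>UNIV. \<Sum>j\<in>UNIV. D (e j) (D (e i) f) z * \<xi> $ i * \<xi> $ j)" if "smooth_on U f" for \<xi> f
    proof (rule dir_deriv2_eq_sum[OF smooth_on_imp_Ck_on[OF that] U z])
      have "(\<Sum>i\<in>UNIV. (\<xi> $ i) *\<^sub>R (e i, 0 :: real)) = (\<Sum>i\<in>UNIV. (\<xi> $ i) *\<^sub>R e i, 0)"
        by (simp add: prod_eq_iff fst_sum snd_sum)
      then show "(\<xi>, 0 :: real) = (\<Sum>i\<in>UNIV. (\<xi> $ i) *\<^sub>R (e i, 0))"
        by (simp add: e_def sum_axis_scaleR)
    qed
    have "(\<Sum>i\<in>UNIV. \<Sum>j\<in>UNIV. A i j * H i j) \<ge> 0"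
    proof (rule trace_product_nonneg)
      show "(\<Sum>i\<in>UNIV. \<Sum>j\<in>UNIV. A i j * x i * x j) \<ge> 0" for x
        unfolding A_def by (rule a_nonneg)
      show "H i j = H j i" for i j
      proof -
        have "w i j = w j i" "w1 i j = w1 j i" "w2 i j = w2 j i"
          unfolding w1 w2 w_def by (intro com smooth_D W z)+
        then show ?thesis by (simp add: H_def)
      qed
      show "(\<Sum>i\<in>UNIV. \<Sum>j\<in>UNIV. H i j * x i * x j) \<ge> 0" for x
      proof -
        define \<xi> where "\<xi> = (\<chi> i. x i)"
        have "(norm \<xi>)\<^sup>2 = (\<Sum>i\<in>UNIV. x i * x i)"
          by (simp add: power2_norm_eq_inner inner_vec_def \<xi>_def)
        then have "(\<Sum>i\<in>UNIV. \<Sum>j\<in>UNIV. (if i = j then 2 * lam * c\<^sup>2 else 0) * x i * x j) = 2 * lam * c\<^sup>2 * (norm \<xi>)\<^sup>2"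
          by (simp add: if_distrib if_distribR sum_distrib_left ac_simps cong: if_cong)
        then have "(\<Sum>i\<in>UNIV. \<Sum>j\<in>UNIV. H i j * x i * x j) = D \<xi> (D \<xi> (D \<alpha> (D \<alpha> W))) z
            + 4 * c * D \<xi> (D \<xi> (D \<alpha> W)) z + 2 * c\<^sup>2 * D \<xi> (D \<xi> W) z - 2 * lam * c\<^sup>2 * (norm \<xi>)\<^sup>2"
          unfolding quad[OF smooth_D[OF smooth_D[OF W]]] quad[OF smooth_D[OF W]] quad[OF W] H_def w1 w2 w_def
          by (simp add: \<xi>_def sum.distrib sum_subtractf sum_distrib_left algebra_simps)
        then show ?thesis using crit(3)[where c = c] by simp
      qed
    qed simp
    moreover have "(\<Sum>i\<in>UNIV. \<Sum>j\<in>UNIV. A i j * (if i = j then 2 * lam * c\<^sup>2 else 0)) = 2 * lam * c\<^sup>2 * tr"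
      by (simp add: tr_def if_distrib sum_distrib_left ac_simps cong: if_cong)
    ultimately show ?thesis
      unfolding T0_def T1_def T2_def H_def
      by (simp add: sum.distrib sum_subtractf sum_distrib_left algebra_simps)
  qed
  define r0 r1 r2 where "r0 = \<rho> (u 0)" and "r1 = deriv \<rho> (u 0)" and "r2 = deriv (deriv \<rho>) (u 0)"
  have r: "r0 > 0" "r2 = r1\<^sup>2 / (2 * r0)"
    using rho_pos[OF z] rho_ode[OF z] by (auto simp: r0_def r1_def r2_def u0)
  have jrho: "has_jet2 (\<lambda>s. \<rho> (u s) * S s) (r0 * (T1 + lam * X1) + r1 * u1 * T0)
      (r0 * (T2 + 2 * lam * X3 + lam\<^sup>2 * X2) + 2 * (r1 * u1) * (T1 + lam * X1) + (r2 * u1\<^sup>2 + r1 * lam) * T0)"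
    using has_jet2_mult[OF has_jet2_compose_real[OF smooth_on_imp_Ck_on[OF rho_smooth] ju] jS]
    unfolding S0 r0_def r1_def r2_def .
  have main: "lam * (r1 * T0 + 2 * r1 * u1 * X1 + r0 * (lam * X2 + 2 * X3) + r2 * u1\<^sup>2 * tr)
     \<le> r0 * (T2 + 2 * lam * X3 + lam\<^sup>2 * X2) + 2 * (r1 * u1) * (T1 + lam * X1) + (r2 * u1\<^sup>2 + r1 * lam) * T0"
  proof -
    \<comment> \<open>This makes \<open>4 * c * r0\<close> the coefficient of \<open>T1\<close>, and
      the equation for \<rho> makes \<open>2 * c\<^sup>2 * r0\<close> the coefficient
      \<open>r2 * u1\<^sup>2\<close> of \<open>T0\<close>. The price is the \<open>tr\<close> term
      in \<open>evolution_factor\<close>.\<close>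
    define c where "c = r1 * u1 / (2 * r0)"
    have c: "4 * c * r0 = 2 * (r1 * u1)" "2 * c\<^sup>2 * r0 = r2 * u1\<^sup>2"
      using r by (simp_all add: c_def field_simps power2_eq_square)
    have "0 \<le> r0 * (T2 + 4 * c * T1 + 2 * c\<^sup>2 * T0 - 2 * lam * c\<^sup>2 * tr)"
      using r(1) trace[of c] by simp
    also have "\<dots> = r0 * T2 + (4 * c * r0) * T1 + (2 * c\<^sup>2 * r0) * T0 - lam * (2 * c\<^sup>2 * r0) * tr"
      by (simp add: algebra_simps)
    finally show ?thesis unfolding c by (simp add: algebra_simps power2_eq_square)
  qed
  obtain B1 B1' where b1: "has_jet2 (\<lambda>s. b1 (u s) * norm (q s) powr p) B1' B1" "lam * lower_order b1 p z \<alpha> \<le> B1"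
    using lower_order_jet[OF b_smooth(1) b_convex(1) p ju u0 u1_def jq q0 \<alpha> lam(2,1)] by blast
  obtain B2 B2' where b2: "has_jet2 (\<lambda>s. b2 (u s) * norm (q s) powr 2) B2' B2" "lam * lower_order b2 2 z \<alpha> \<le> B2"
    using lower_order_jet[OF b_smooth(2) b_convex(2) order_refl ju u0 u1_def jq q0 \<alpha> lam(2,1)] by blast
  have b3: "has_jet2 (\<lambda>s. b3 (u s)) (deriv b3 (u 0) * u1) (deriv (deriv b3) (u 0) * u1\<^sup>2 + deriv b3 (u 0) * lam)"
    by (rule has_jet2_compose_real[OF smooth_on_imp_Ck_on[OF b_smooth(3)] ju])
  have b3': "lam * \<bar>deriv b3 (W z)\<bar> \<le> deriv (deriv b3) (u 0) * u1\<^sup>2 + deriv b3 (u 0) * lam"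
  proof -
    have "deriv (deriv b3) (u 0) * u1\<^sup>2 \<ge> 0"
      using convex_on_imp_deriv2_nonneg[OF smooth_on_imp_Ck_on[OF b_smooth(3)] b_convex(3)] by simp
    moreover have "lam * \<bar>deriv b3 (W z)\<bar> \<le> lam * deriv b3 (W z)"
      using lam(2) by (intro mult_left_mono_neg) auto
    ultimately show ?thesis by (simp add: u0 mult.commute)
  qed
  note jR = has_jet2_add[OF has_jet2_add[OF has_jet2_add[OF jrho b1(1)] b2(1)] b3]
  have inU: "\<forall>\<^sub>F s in nhds 0. l s \<in> U"
    unfolding l_def by (rule eventually_line_in_open[OF U z])
  have "\<forall>\<^sub>F s in nhds 0. \<rho> (u s) * S s + b1 (u s) * norm (q s) powr p + b2 (u s) * norm (q s) powr 2 + b3 (u s)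
      = dir_deriv U (0, 1) W (l s)"
    using inU by eventually_elim (simp only: pde u_def q_def S_def e_def)
  from has_jet2_cong[OF this jR]
  have jR': "has_jet2 (\<lambda>s. dir_deriv U (0, 1) W (l s)) (r0 * (T1 + lam * X1) + r1 * u1 * T0 + B1' + B2' + deriv b3 (u 0) * u1)
      (r0 * (T2 + 2 * lam * X3 + lam\<^sup>2 * X2) + 2 * (r1 * u1) * (T1 + lam * X1) + (r2 * u1\<^sup>2 + r1 * lam) * T0
       + B1 + B2 + (deriv (deriv b3) (u 0) * u1\<^sup>2 + deriv b3 (u 0) * lam))" .
  \<comment> \<open>The same curve differentiated directly; afterwards the time direction is moved
    outside.\<close>
  have "has_jet2 (\<lambda>s. dir_deriv U (0, 1) W (l s)) (D \<alpha> (dir_deriv U (0, 1) W) z) (D \<alpha> (D \<alpha> (dir_deriv U (0, 1) W)) z)"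
    unfolding l_def by (rule has_jet2_sline[OF smooth_on_dir_deriv[OF W] z])
  from has_jet2_unique(2)[OF this jR'] have "dir_deriv U (0, 1) (D \<alpha> (D \<alpha> W)) z =
     r0 * (T2 + 2 * lam * X3 + lam\<^sup>2 * X2) + 2 * (r1 * u1) * (T1 + lam * X1) + (r2 * u1\<^sup>2 + r1 * lam) * T0
       + B1 + B2 + (deriv (deriv b3) (u 0) * u1\<^sup>2 + deriv b3 (u 0) * lam)"
    using dir_deriv_commute3[OF W U z, of "(\<alpha>, 0)" "(\<alpha>, 0)" "(0, 1)"] by simp
  moreover have "evolution_factor z \<alpha> = (r1 * T0 + 2 * r1 * u1 * X1 + r0 * (lam * X2 + 2 * X3) + r2 * u1\<^sup>2 * tr)
      + lower_order b1 p z \<alpha> + lower_order b2 2 z \<alpha> + \<bar>deriv b3 (W z)\<bar>"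
    unfolding evolution_factor_def T0_def X1_def X2_def X3_def tr_def A_def A1_def A2_def w_def w1_def
      r0_def r1_def r2_def u0 q0 u1_def e_def lam(1) by simp
  ultimately show ?thesis
    using main b1(2) b2(2) b3' by (simp add: distrib_left)
qed

lemma continuous_on_sgrad: "continuous_on U (sgrad U W)"
  unfolding sgrad_def[abs_def]
  by (intro continuous_intros smooth_on_imp_continuous_on smooth_D W)

text \<open>Gives a bound on compact sets, hence a constant that does not depend on where a minimum
  is attained.\<close>

lemma continuous_on_evolution_factor: "continuous_on (U \<times> UNIV) (\<lambda>(z, \<alpha>). evolution_factor z \<alpha>)"
proof -
  let ?T = "U \<times> (UNIV :: (real ^ 'n) set)"
  have fst: "continuous_on ?T fst" "fst ` ?T \<subseteq> U" by (auto intro: continuous_intros)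
  have g: "continuous_on ?T (\<lambda>x. sgrad U W (fst x))"
    by (rule continuous_on_compose2[OF continuous_on_sgrad fst])
  have snd: "continuous_on ?T (\<lambda>x. (snd x, 0 :: real))" by (intro continuous_intros)
  have real: "continuous_on ?T (\<lambda>x. f (W (fst x)))" "continuous_on ?T (\<lambda>x. deriv f (W (fst x)))"
    "continuous_on ?T (\<lambda>x. deriv (deriv f) (W (fst x)))" if f: "smooth_on UNIV f" for f
  proof -
    have Wc: "continuous_on ?T (\<lambda>x. W (fst x))"
      by (rule continuous_on_compose2[OF smooth_on_imp_continuous_on[OF W] fst])
    have eq: "dir_deriv UNIV 1 h = deriv h" if "smooth_on UNIV h" for h :: "real \<Rightarrow> real"
      using dir_deriv_real[OF smooth_on_imp_differentiable_on[OF that], of 1] by auto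
    have f': "smooth_on UNIV (deriv f)" using smooth_on_dir_deriv[OF f, of 1] eq[OF f] by simp
    have f'': "smooth_on UNIV (deriv (deriv f))" using smooth_on_dir_deriv[OF f', of 1] eq[OF f'] by simp
    show "continuous_on ?T (\<lambda>x. f (W (fst x)))" "continuous_on ?T (\<lambda>x. deriv f (W (fst x)))"
      "continuous_on ?T (\<lambda>x. deriv (deriv f) (W (fst x)))"
      using f f' f'' by (auto intro!: continuous_on_compose2[OF smooth_on_imp_continuous_on Wc])
  qed
  have D1: "continuous_on ?T (\<lambda>x. D (snd x) f (fst x))" if "smooth_on U f" for f
    by (rule continuous_on_dir_deriv[OF that snd fst])
  have D2: "continuous_on ?T (\<lambda>x. D (snd x) (D (snd x) W) (fst x))"
    by (rule continuous_on_dir_deriv2[OF W U snd fst])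
  have Dij: "continuous_on ?T (\<lambda>x. D v (D v' W) (fst x))" for v v'
    by (rule continuous_on_compose2[OF smooth_on_imp_continuous_on fst]) (intro smooth_D W)
  have a0: "continuous_on ?T (\<lambda>x. a i j (sgrad U W (fst x)))" for i j
    by (rule continuous_on_compose2[OF smooth_on_imp_continuous_on[OF a_smooth] g]) simp
  have a1: "continuous_on ?T (\<lambda>x. dir_deriv UNIV (snd x) (a i j) (sgrad U W (fst x)))" for i j
    by (intro continuous_on_dir_deriv a_smooth g continuous_intros) simp
  have a2: "continuous_on ?T (\<lambda>x. dir_deriv UNIV (snd x) (dir_deriv UNIV (snd x) (a i j)) (sgrad U W (fst x)))" for i j
    by (intro continuous_on_dir_deriv2 a_smooth g continuous_intros) simp_all
  \<comment> \<open>The base is at least 1, so the power is continuous even where the gradient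
    vanishes.\<close>
  have pw: "continuous_on ?T (\<lambda>x. (1 + norm (sgrad U W (fst x))) powr r)" for r
    by (intro continuous_intros g) (smt (verit) norm_ge_zero)
  have lo: "continuous_on ?T (\<lambda>x. lower_order f r (fst x) (snd x))" if f: "smooth_on UNIV f" for f r
    unfolding lower_order_def
    by (intro continuous_on_add continuous_on_mult continuous_on_rabs continuous_on_const real[OF f] D1 D2 W pw)
  show ?thesis
    unfolding evolution_factor_def case_prod_beta
    by (intro continuous_on_add continuous_on_mult continuous_on_sum continuous_on_power
        continuous_on_rabs continuous_on_const real[OF rho_smooth] real(2)[OF b_smooth(3)]
        lo[OF b_smooth(1)] lo[OF b_smooth(2)] a0 a1 a2 D1 D2 Dij W smooth_D)
qed

end

section \<open>The maximum principle argument\<close>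

lemma dir_deriv_slice:
  fixes F :: "'a::real_normed_vector \<times> real \<Rightarrow> real"
  assumes "F differentiable_on U" "open U" "open \<Omega>" "x \<in> \<Omega>" "(x, t) \<in> U"
  shows "dir_deriv \<Omega> v (\<lambda>y. F (y, t)) x = dir_deriv U (v, 0) F (x, t)"
proof (rule dir_deriv_eqI[OF _ assms(3,4)])
  show "((\<lambda>y. F (y, t)) has_derivative (\<lambda>h. dir_deriv U (h, 0) F (x, t))) (at x)"
    by (rule has_derivative_compose[where f = "\<lambda>y. (y, t)" and g = F])
      (auto intro!: derivative_eq_intros has_derivative_dir_deriv assms)
qed

lemma dir_deriv2_closure:
  assumes "open \<Omega>" "x \<in> \<Omega>"
  shows "dir_deriv2 (closure \<Omega>) u v f x = dir_deriv \<Omega> v (dir_deriv \<Omega> u f) x"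
proof -
  note sub = dir_deriv_open_subset[OF assms(1) closure_subset, symmetric]
  have "dir_deriv2 (closure \<Omega>) u v f x = dir_deriv \<Omega> v (dir_deriv (closure \<Omega>) u f) x"
    unfolding dir_deriv2_def by (rule sub[OF assms(2)])
  also have "\<dots> = dir_deriv \<Omega> v (dir_deriv \<Omega> u f) x"
    by (intro dir_deriv_cong sub assms)
  finally show ?thesis .
qed

text \<open>Links space derivatives within the closure at a fixed time to space-time derivatives on
  the open set \<open>U\<close>.\<close>

lemma dir_deriv2_slice:
  fixes F :: "'a::real_normed_vector \<times> real \<Rightarrow> real"
  assumes F: "smooth_on U F" "open U" and "open \<Omega>" "\<Omega> \<times> {t} \<subseteq> U" "x \<in> \<Omega>"
  shows "dir_deriv2 (closure \<Omega>) u v (\<lambda>y. F (y, t)) x = dir_deriv U (v, 0) (dir_deriv U (u, 0) F) (x, t)"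
proof -
  have "dir_deriv2 (closure \<Omega>) u v (\<lambda>y. F (y, t)) x = dir_deriv \<Omega> v (\<lambda>y. dir_deriv U (u, 0) F (y, t)) x"
    unfolding dir_deriv2_closure[OF assms(3,5)]
    using assms by (intro dir_deriv_cong dir_deriv_slice smooth_on_imp_differentiable_on) auto
  also have "\<dots> = dir_deriv U (v, 0) (dir_deriv U (u, 0) F) (x, t)"
    using assms by (intro dir_deriv_slice smooth_on_imp_differentiable_on smooth_on_dir_deriv) auto
  finally show ?thesis .
qed

text \<open>Carries bounds from unit vectors to all vectors; \<open>sgn 0 = 0\<close> covers
  \<open>v = 0\<close>.\<close>

lemma dir_deriv2_norm_sgn:
  assumes "Ck_on 2 S f" "open S" "x \<in> S"
  shows "dir_deriv S (v, 0) (dir_deriv S (v, 0) f) x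
    = (norm v)\<^sup>2 * dir_deriv S (sgn v, 0) (dir_deriv S (sgn v, 0) f) x"
proof -
  have "(v, 0) = (\<Sum>i\<in>{()}. norm v *\<^sub>R (sgn v, 0))"
    by (cases "v = 0") (simp_all add: sgn_div_norm)
  from dir_deriv2_eq_sum[OF assms this] show ?thesis
    by (simp add: power2_eq_square)
qed

text \<open>On a segment the second derivative of \<open>f\<close> is the Hessian form in its
  direction, which reduces convexity to one variable.\<close>

lemma convex_on_if_dir_deriv2_nonneg:
  fixes f :: "'a::real_normed_vector \<Rightarrow> real"
  assumes f: "Ck_on 2 S f" and S: "open S" "convex S"
    and nonneg: "\<And>x v. x \<in> S \<Longrightarrow> dir_deriv S v (dir_deriv S v f) x \<ge> 0"
  shows "convex_on S f"
proof (rule convex_onI[OF _ S(2)])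
  fix t :: real and x y :: 'a
  assume t: "0 < t" "t < 1" and xy: "x \<in> S" "y \<in> S"
  have d: "f differentiable_on S" "\<And>u. dir_deriv S u f differentiable_on S"
    using f by (auto simp: eval_nat_numeral)
  define v where "v = y - x"
  have eq: "x + s *\<^sub>R v = (1 - s) *\<^sub>R x + s *\<^sub>R y" for s
    by (simp add: v_def algebra_simps)
  have inS: "x + s *\<^sub>R v \<in> S" if "s \<in> {0..1}" for s
    unfolding eq using S(2) xy that by (intro convexD) auto
  have "convex_on {0..1} (\<lambda>s. f (x + s *\<^sub>R v))"
    by (rule f''_ge0_imp_convex[OF _ has_real_derivative_along_line[OF d(1) S(1) inS]
          has_real_derivative_along_line[OF d(2) S(1) inS] nonneg[OF inS]]) auto
  from convex_onD[OF this, of t 0 1] t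
  have "f (x + t *\<^sub>R v) \<le> (1 - t) * f (x + 0 *\<^sub>R v) + t * f (x + 1 *\<^sub>R v)"
    by simp
  then show "f ((1 - t) *\<^sub>R x + t *\<^sub>R y) \<le> (1 - t) * f x + t * f y"
    unfolding eq by simp
qed

text \<open>Only earlier times are compared, since a minimum over a closed time interval may sit at
  its end.\<close>

lemma derivative_nonpos_if_left_min:
  fixes f :: "real \<Rightarrow> real"
  assumes "(f has_real_derivative l) (at t)" "t > 0" "\<And>s. 0 < s \<Longrightarrow> s \<le> t \<Longrightarrow> f t \<le> f s"
  shows "l \<le> 0"
proof (rule ccontr)
  assume "\<not> l \<le> 0"
  then obtain d where d: "d > 0" "\<And>h. 0 < h \<Longrightarrow> h < d \<Longrightarrow> f (t - h) < f t"
    using DERIV_pos_inc_left[OF assms(1)] by auto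
  define h where "h = min d t / 2"
  have "0 < h" "h < d" "h < t" using d(1) assms(2) by (auto simp: h_def)
  then show False using d(2)[of h] assms(3)[of "t - h"] by auto
qed

lemma INF_ereal_gt_0D:
  assumes "(INF z\<in>A. INF e\<in>B. ereal (f z e)) > 0" "z \<in> A" "e \<in> B"
  shows "f z e > 0"
proof -
  have "(INF z\<in>A. INF e\<in>B. ereal (f z e)) \<le> ereal (f z e)"
    using assms(2,3) by (meson INF_lower INF_lower2)
  with assms(1) show ?thesis using less_le_trans by fastforce
qed

theorem lemma2p1:
  fixes \<Omega> :: "(real ^ 'n) set"
    and p c0 :: real
    and a :: "'n \<Rightarrow> 'n \<Rightarrow> real ^ 'n \<Rightarrow> real"
    and b1 b2 b3 \<rho> :: "real \<Rightarrow> real"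
    and w :: "real ^ 'n \<Rightarrow> real \<Rightarrow> real"
  assumes domain: "open \<Omega>" "connected \<Omega>" "\<Omega> \<noteq> {}" "bounded \<Omega>"
      "strictly_convex_set \<Omega>" "smooth_boundary \<Omega>"
    and p: "p \<ge> 2"
    and a_smooth: "\<And>i j. smooth_on UNIV (a i j)"
    and b_smooth: "smooth_on UNIV b1" "smooth_on UNIV b2" "smooth_on UNIV b3"
    and c0: "c0 > 0"
    and elliptic: "\<And>q \<xi>. \<xi> \<noteq> 0 \<Longrightarrow>
      (\<Sum>i\<in>UNIV. \<Sum>j\<in>UNIV. a i j q * \<xi> $ i * \<xi> $ j) \<ge> c0 * (norm \<xi>)\<^sup>2"
    and rho_smooth: "smooth_on UNIV \<rho>"
    and rho_pos: "\<And>s. s \<noteq> 0 \<Longrightarrow> \<rho> s > 0"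
    and b_convex: "convex_on UNIV b1" "convex_on UNIV b2" "convex_on UNIV b3"
    and rho_ode: "\<And>s. s \<noteq> 0 \<Longrightarrow> deriv (deriv \<rho>) s - (deriv \<rho> s)\<^sup>2 / (2 * \<rho> s) = 0"
    and w_smooth: "smooth_on (\<Omega> \<times> {0..}) (\<lambda>(x, t). w x t)"
    and w_boundary: "spatially_C2_up_to_boundary \<Omega> w"
    and w_pos: "\<And>x t. x \<in> \<Omega> \<Longrightarrow> t \<ge> 0 \<Longrightarrow> w x t > 0"
    and w_pde: "\<And>x t. x \<in> \<Omega> \<Longrightarrow> t \<ge> 0 \<Longrightarrow>
      time_deriv w x t =
        \<rho> (w x t) * (\<Sum>i\<in>UNIV. \<Sum>j\<in>UNIV.
            a i j (space_grad \<Omega> w x t) * space_deriv2 \<Omega> (axis i 1) (axis j 1) w x t)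
        + b1 (w x t) * norm (space_grad \<Omega> w x t) powr p
        + b2 (w x t) * (norm (space_grad \<Omega> w x t))\<^sup>2
        + b3 (w x t)"
    and lateral: "(INF (x, t)\<in>frontier \<Omega> \<times> {0..}. INF e\<in>sphere 0 1.
        ereal (space_deriv2 \<Omega> e e w x t)) > 0"
    and initial: "(INF x\<in>\<Omega>. INF e\<in>sphere 0 1. ereal (space_deriv2 \<Omega> e e w x 0)) > 0"
  shows "(\<forall>t>0. convex_on \<Omega> (\<lambda>x. w x t)) \<and>
    (INF (x, t)\<in>\<Omega> \<times> {0..}. INF e\<in>sphere 0 1. ereal (space_deriv2 \<Omega> e e w x t)) \<ge> 0"
proof -
  \<comment> \<open>Time 0 is left out to make \<open>U\<close> open; that slice is handled by the
    initial condition.\<close>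
  define U where "U = \<Omega> \<times> {0 :: real<..}"
  define W where "W = (\<lambda>(x, t). w x t)"
  have U: "open U" unfolding U_def using domain(1) by (intro open_Times) auto
  have W: "smooth_on U W"
    unfolding W_def by (rule smooth_on_open_subset[OF U _ w_smooth]) (auto simp: U_def)
  have Wd: "W differentiable_on U" by (rule smooth_on_imp_differentiable_on[OF W])
  have w_W: "w x t = W (x, t)" for x t by (simp add: W_def)
  have UI: "(x, t) \<in> U" if "x \<in> \<Omega>" "t > 0" for x t
    using that by (simp add: U_def)
  have closure: "x \<in> \<Omega> \<or> x \<in> frontier \<Omega>" if "x \<in> closure \<Omega>" for x
    using that domain(1) by (simp add: frontier_def interior_open)
  have convex: "convex \<Omega>"
    unfolding convex_contains_open_segment
    using domain(1,5) closure_subset[of \<Omega>] unfolding strictly_convex_set_def interior_open[OF domain(1)] by blast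

  have deriv2_eq: "space_deriv2 \<Omega> u v w x t = sderiv U v (sderiv U u W) (x, t)" if "x \<in> \<Omega>" "t > 0" for u v x t
    unfolding space_deriv2_def w_W
    by (rule dir_deriv2_slice[OF W U domain(1) _ that(1)]) (use that in \<open>auto simp: U_def\<close>)
  have grad_eq: "space_grad \<Omega> w x t = sgrad U W (x, t)" if "x \<in> \<Omega>" "t > 0" for x t
    using dir_deriv_slice[OF Wd U domain(1) that(1) UI[OF that]]
      dir_deriv_open_subset[OF domain(1) closure_subset that(1), of _ "\<lambda>y. W (y, t)"]
    by (simp add: space_grad_def gradient_def sgrad_def w_W)
  have time_line: "((\<lambda>s. f (x, s)) has_real_derivative dir_deriv U (0, 1) f (x, t)) (at t)"
    if "x \<in> \<Omega>" "t > 0" "f differentiable_on U" for f x t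
    using has_real_derivative_along_line[OF that(3) U, of "(x, 0)" t "(0, 1)"] UI[OF that(1,2)] by simp
  have time_eq: "time_deriv w x t = dir_deriv U (0, 1) W (x, t)" if "x \<in> \<Omega>" "t > 0" for x t
  proof -
    have "at t within {0..} = at t"
      by (rule at_within_interior) (use that in simp)
    then show ?thesis
      using time_line[OF that Wd] unfolding time_deriv_def w_W
      by (simp add: has_real_derivative_iff_has_vector_derivative vector_derivative_at)
  qed

  interpret quasilinear_flow U W a b1 b2 b3 \<rho> p
  proof
    show "(\<Sum>i\<in>UNIV. \<Sum>j\<in>UNIV. a i j q * \<xi> i * \<xi> j) \<ge> 0" for q and \<xi> :: "'n \<Rightarrow> real"
    proof (cases "(\<chi> i. \<xi> i) = 0")
      case True
      then have "\<xi> i = 0" for i by (simp add: vec_eq_iff)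
      then show ?thesis by simp
    next
      case False
      have "0 \<le> c0 * (norm (\<chi> i. \<xi> i))\<^sup>2" using c0 by simp
      also have "\<dots> \<le> (\<Sum>i\<in>UNIV. \<Sum>j\<in>UNIV. a i j q * \<xi> i * \<xi> j)"
        using elliptic[OF False, of q] by simp
      finally show ?thesis .
    qed
    fix z assume "z \<in> U"
    then obtain x t where z: "z = (x, t)" "x \<in> \<Omega>" "t > 0" by (auto simp: U_def)
    have "W z \<noteq> 0" using w_pos[of x t] z by (simp add: W_def)
    then show "\<rho> (W z) > 0" "deriv (deriv \<rho>) (W z) = (deriv \<rho> (W z))\<^sup>2 / (2 * \<rho> (W z))"
      using rho_pos rho_ode[of "W z"] by auto
    show "dir_deriv U (0, 1) W z =
        \<rho> (W z) * (\<Sum>i\<in>UNIV. \<Sum>j\<in>UNIV. a i j (sgrad U W z) * sderiv U (axis j 1) (sderiv U (axis i 1) W) z)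
        + b1 (W z) * norm (sgrad U W z) powr p + b2 (W z) * norm (sgrad U W z) powr 2 + b3 (W z)"
      using w_pde[of x t] z
      by (simp add: deriv2_eq grad_eq time_eq powr_numeral w_W)
  qed (fact U W a_smooth b_smooth b_convex rho_smooth p)+

  \<comment> \<open>The Hessian form in coordinates: a finite sum that is jointly continuous in
    point, time and direction up to the boundary.\<close>
  define H where "H y = (\<Sum>i\<in>UNIV. \<Sum>j\<in>UNIV.
      space_deriv2 \<Omega> (axis i 1) (axis j 1) w (fst (fst y)) (snd (fst y)) * snd y $ i * snd y $ j)"
    for y :: "((real ^ 'n) \<times> real) \<times> (real ^ 'n)"
  have deriv2_cont: "continuous_on (closure \<Omega> \<times> {0..}) (\<lambda>z. space_deriv2 \<Omega> u v w (fst z) (snd z))" for u v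
    using w_boundary unfolding spatially_C2_up_to_boundary_def space_deriv2_def by (simp add: case_prod_beta)
  \<comment> \<open>In \<Omega> this is linearity in the directions; both sides are continuous in
    \<open>x\<close>, so it extends to the closure.\<close>
  have deriv2_H: "space_deriv2 \<Omega> e e w x t = H ((x, t), e)" if "x \<in> closure \<Omega>" "t \<ge> 0" for e x t
  proof -
    have "space_deriv2 \<Omega> e e w x t - H ((x, t), e) = 0"
    proof (rule continuous_constant_on_closure[OF _ _ that(1), where f = "\<lambda>x. space_deriv2 \<Omega> e e w x t - H ((x, t), e)"])
      have "continuous_on (closure \<Omega>) (\<lambda>x. space_deriv2 \<Omega> u v w x t)" for u v
        using that(2) by (intro continuous_on_compose2[OF deriv2_cont, where f = "\<lambda>x. (x, t)", simplified])
          (auto intro!: continuous_intros)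
      then show "continuous_on (closure \<Omega>) (\<lambda>x. space_deriv2 \<Omega> e e w x t - H ((x, t), e))"
        unfolding H_def fst_conv snd_conv by (intro continuous_intros)
      fix x assume x: "x \<in> \<Omega>"
      have "Ck_on 2 (closure \<Omega>) (\<lambda>x. w x t)"
        using w_boundary that(2) unfolding spatially_C2_up_to_boundary_def by simp
      then have C2: "Ck_on 2 \<Omega> (\<lambda>x. w x t)"
        by (rule Ck_on_open_subset[OF domain(1) closure_subset])
      have "e = (\<Sum>i\<in>UNIV. (e $ i) *\<^sub>R axis i 1)" by (simp add: sum_axis_scaleR)
      from dir_deriv2_eq_sum[OF C2 domain(1) x this]
      show "space_deriv2 \<Omega> e e w x t - H ((x, t), e) = 0"
        by (simp add: H_def space_deriv2_def dir_deriv2_closure[OF domain(1) x])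
    qed
    then show ?thesis by simp
  qed

  have nonneg: "space_deriv2 \<Omega> e e w x t \<ge> 0" if "x \<in> \<Omega>" "t \<ge> 0" "norm e = 1" for x t e
  proof (rule ccontr)
    assume neg: "\<not> space_deriv2 \<Omega> e e w x t \<ge> 0"
    define K where "K = (closure \<Omega> \<times> {0..t}) \<times> sphere (0 :: real ^ 'n) 1"
    have "compact K"
      unfolding K_def using domain(4) by (intro compact_Times) (auto simp: compact_closure)
    have H_cont: "continuous_on K H"
      unfolding H_def K_def
      by (intro continuous_intros continuous_on_compose2[OF deriv2_cont]) auto
    \<comment> \<open>The strict boundary and initial conditions keep this compact set inside
      \<open>U\<close>. Bounding the evolution factor on all of \<open>Q\<close> fixes
      \<open>C\<close> before \<kappa>, and with it the minimum point, is chosen.\<close>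
    define Q where "Q = K \<inter> H -` {..0}"
    have "closed Q"
      unfolding Q_def by (intro continuous_closed_preimage H_cont compact_imp_closed[OF \<open>compact K\<close>] closed_atMost)
    then have "compact Q"
      using compact_Int_closed[OF \<open>compact K\<close>, of Q] by (simp add: Q_def Int_absorb1)
    have start: "((x, t), e) \<in> Q" "((x, t), e) \<in> K" "H ((x, t), e) < 0"
      using that neg deriv2_H[of x t e] closure_subset[of \<Omega>] by (auto simp: Q_def K_def)
    have QU: "y \<in> U \<and> norm \<alpha> = 1" if "(y, \<alpha>) \<in> Q" for y \<alpha>
    proof -
      obtain x s where y: "y = (x, s)" by (cases y)
      have xs: "x \<in> closure \<Omega>" "0 \<le> s" "norm \<alpha> = 1" "H ((x, s), \<alpha>) \<le> 0"
        using that by (auto simp: Q_def K_def y)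
      have "x \<notin> frontier \<Omega>"
      proof
        assume "x \<in> frontier \<Omega>"
        then have "space_deriv2 \<Omega> \<alpha> \<alpha> w x s > 0"
          using INF_ereal_gt_0D[OF lateral[unfolded case_prod_beta], of "(x, s)" \<alpha>] xs by simp
        then show False using deriv2_H xs by simp
      qed
      then have "x \<in> \<Omega>" using closure[OF xs(1)] by simp
      moreover have "s \<noteq> 0"
      proof
        assume "s = 0"
        have "space_deriv2 \<Omega> \<alpha> \<alpha> w x 0 > 0"
          by (rule INF_ereal_gt_0D[OF initial \<open>x \<in> \<Omega>\<close>]) (use xs in simp)
        then show False using deriv2_H xs \<open>s = 0\<close> by simp
      qed
      ultimately show ?thesis using xs by (simp add: y U_def)
    qed
    have "Q \<subseteq> U \<times> UNIV" using QU by auto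
    then have "continuous_on Q (\<lambda>(z, \<alpha>). evolution_factor z \<alpha>)"
      by (rule continuous_on_subset[OF continuous_on_evolution_factor])
    from continuous_attains_sup[OF \<open>compact Q\<close> _ this] start(1)
    obtain C where C: "\<And>z \<alpha>. (z, \<alpha>) \<in> Q \<Longrightarrow> evolution_factor z \<alpha> \<le> C"
      by (smt (verit) case_prod_conv empty_iff)
    \<comment> \<open>The extra 1 turns the final comparison
      \<open>lam * C \<le> \<kappa> * lam\<close> into \<open>0 \<le> lam\<close>.\<close>
    define \<kappa> where "\<kappa> = C + 1"
    have "continuous_on K (\<lambda>y. exp (- \<kappa> * snd (fst y)) * H y)"
      by (intro continuous_intros H_cont)
    from continuous_attains_inf[OF \<open>compact K\<close> _ this] start(2)
    obtain m where m: "m \<in> K" "\<And>y. y \<in> K \<Longrightarrow> exp (- \<kappa> * snd (fst m)) * H m \<le> exp (- \<kappa> * snd (fst y)) * H y"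
      by blast
    obtain x0 t0 \<alpha> where m_eq: "m = ((x0, t0), \<alpha>)" by (metis prod.collapse)
    define lam where "lam = H m"
    \<comment> \<open>The minimum is at most the weighted value at the assumed counterexample, which
      is negative; so the minimiser lies in \<open>Q\<close>.\<close>
    have "exp (- \<kappa> * t0) * lam < 0"
      using m(2)[OF start(2)] start(3) mult_pos_neg[of "exp (- \<kappa> * t)" "H ((x, t), e)"] by (simp add: lam_def m_eq)
    then have lam_neg: "lam < 0" by (simp add: mult_less_0_iff)
    then have "((x0, t0), \<alpha>) \<in> Q" using m(1) by (simp add: Q_def lam_def m_eq)
    then have z0: "(x0, t0) \<in> U" "norm \<alpha> = 1" and EC: "evolution_factor (x0, t0) \<alpha> \<le> C"
      using QU C by auto
    have x0: "x0 \<in> \<Omega>" "t0 > 0" "t0 \<le> t" using z0(1) m(1) by (auto simp: U_def K_def m_eq)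
    have H_D: "H ((y, s), v) = D v (D v W) (y, s)" if "y \<in> \<Omega>" "s > 0" for y s v
      using deriv2_H[of y s v] deriv2_eq[OF that] that closure_subset[of \<Omega>] by auto
    have lam: "lam = D \<alpha> (D \<alpha> W) (x0, t0)" using H_D[OF x0(1,2)] by (simp add: lam_def m_eq)
    have "\<forall>\<^sub>F y in nhds x0. y \<in> \<Omega>" using domain(1) x0(1) by (rule eventually_nhds_in_open)
    \<comment> \<open>At the fixed time \<open>t0\<close> the exponential weight cancels; scaling
      extends the bound from unit vectors to all \<open>v\<close>.\<close>
    then have min: "\<forall>\<^sub>F y in nhds (fst (x0, t0)). \<forall>v. lam * (norm v)\<^sup>2 \<le> D v (D v W) (y, snd (x0, t0))"
      unfolding fst_conv snd_conv
    proof eventually_elim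
      case (elim y)
      show ?case
      proof
        fix v :: "real ^ 'n"
        show "lam * (norm v)\<^sup>2 \<le> D v (D v W) (y, t0)"
        proof (cases "v = 0")
          case False
          then have "((y, t0), sgn v) \<in> K"
            using elim x0 closure_subset[of \<Omega>] by (auto simp: K_def norm_sgn)
          from m(2)[OF this] have "lam \<le> D (sgn v) (D (sgn v) W) (y, t0)"
            by (simp add: m_eq lam_def H_D[OF elim x0(2)])
          from mult_left_mono[OF this, of "(norm v)\<^sup>2"] show ?thesis
            unfolding dir_deriv2_norm_sgn[OF smooth_on_imp_Ck_on[OF W] U UI[OF elim x0(2)], of v]
            by (simp add: mult.commute)
        qed (use dir_deriv2_norm_sgn[OF smooth_on_imp_Ck_on[OF W] U UI[OF elim x0(2)], of v] in simp)
      qed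
    qed
    have evol: "lam * evolution_factor (x0, t0) \<alpha> \<le> dir_deriv U (0, 1) (D \<alpha> (D \<alpha> W)) (x0, t0)"
      by (rule evolution_at_minimum[OF z0 lam _ min]) (use lam_neg in simp)
    have "((\<lambda>s. exp (- \<kappa> * s) * D \<alpha> (D \<alpha> W) (x0, s)) has_real_derivative
        exp (- \<kappa> * t0) * (dir_deriv U (0, 1) (D \<alpha> (D \<alpha> W)) (x0, t0) - \<kappa> * lam)) (at t0)"
      by (auto intro!: derivative_eq_intros time_line[OF x0(1,2)] smooth_on_imp_differentiable_on W
          simp: lam algebra_simps)
    then have "exp (- \<kappa> * t0) * (dir_deriv U (0, 1) (D \<alpha> (D \<alpha> W)) (x0, t0) - \<kappa> * lam) \<le> 0"
    proof (rule derivative_nonpos_if_left_min[OF _ x0(2)])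
      fix s assume s: "0 < s" "s \<le> t0"
      have "((x0, s), \<alpha>) \<in> K" using m(1) s x0(3) by (auto simp: K_def m_eq)
      from m(2)[OF this]
      show "exp (- \<kappa> * t0) * D \<alpha> (D \<alpha> W) (x0, t0) \<le> exp (- \<kappa> * s) * D \<alpha> (D \<alpha> W) (x0, s)"
        using H_D[OF x0(1)] s x0(2) by (simp add: m_eq)
    qed
    then have "dir_deriv U (0, 1) (D \<alpha> (D \<alpha> W)) (x0, t0) \<le> \<kappa> * lam"
      by (simp add: mult_le_0_iff)
    moreover have "lam * C \<le> lam * evolution_factor (x0, t0) \<alpha>"
      using EC lam_neg by (intro mult_left_mono_neg) auto
    moreover have "\<kappa> * lam = lam * C + lam" by (simp add: \<kappa>_def algebra_simps)
    ultimately show False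
      using evol lam_neg by linarith
  qed

  have "convex_on \<Omega> (\<lambda>x. w x t)" if t: "t > 0" for t
  proof (rule convex_on_if_dir_deriv2_nonneg[OF _ domain(1) convex])
    have "Ck_on 2 (closure \<Omega>) (\<lambda>x. w x t)"
      using w_boundary t unfolding spatially_C2_up_to_boundary_def by simp
    then show C2: "Ck_on 2 \<Omega> (\<lambda>x. w x t)"
      by (rule Ck_on_open_subset[OF domain(1) closure_subset])
    fix x v assume x: "x \<in> \<Omega>"
    have "dir_deriv \<Omega> v (dir_deriv \<Omega> v (\<lambda>x. w x t)) x = D v (D v W) (x, t)"
      using deriv2_eq[OF x t, of v v] dir_deriv2_closure[OF domain(1) x] by (simp add: space_deriv2_def)
    also have "\<dots> = (norm v)\<^sup>2 * D (sgn v) (D (sgn v) W) (x, t)"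
      by (rule dir_deriv2_norm_sgn[OF smooth_on_imp_Ck_on[OF W] U UI[OF x t]])
    also have "\<dots> \<ge> 0"
      using nonneg[OF x _ norm_sgn[of v, THEN trans], of t] deriv2_eq[OF x t, of "sgn v" "sgn v"] t
      by (cases "v = 0") auto
    finally show "dir_deriv \<Omega> v (dir_deriv \<Omega> v (\<lambda>x. w x t)) x \<ge> 0" .
  qed
  moreover have "(INF (x, t)\<in>\<Omega> \<times> {0..}. INF e\<in>sphere 0 1. ereal (space_deriv2 \<Omega> e e w x t)) \<ge> 0"
    using nonneg by (auto intro!: INF_greatest)
  ultimately show ?thesis by blast
qed

end
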